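(* The eventual adaptation problem is undecidable in $\mathcal{E}_s^2$.
   Context: Fix a countably infinite set $\mathcal N$ of names. Prefixes are $\pi ::= a \mid \overline{a} \mid \widetilde{a}\{U\}$. Update patterns extend process terms with a hole $\bullet$; $U\{Q\}$ replaces every hole of $U$ not inside an update prefix by $Q$ (commuting with $a[\cdot]$, $\parallel$, sums and replication). $\mathcal E_s$ processes are generated by $P::=a[P]\mid P\parallel P\mid A$, $A ::= A\parallel A\mid\ !\pi.A\mid \sum_{i\in I}\pi_i.A_i$ ($I$ finite), $\pi::= a\mid\overline a\mid \widetilde a\{a[U]\parallel A\}$, where $U$ is a pattern over this grammar; $\mathcal E_s^2$ further requires every update pattern (at any depth) to be generated by $U::= P\mid a[U]\mid U\parallel U\mid\bullet$, $P$ a hole-free $\mathcal E_s^2$ process. Auxiliary functions: $\mathrm{numap}$ counts located processes not under a prefix ($\mathrm{numap}(\bullet)=0$, $\mathrm{numap}(a[U])=1+\mathrm{numap}(U)$, additive on $\parallel$, $0$ on sums/replications); $\mathrm{numholes}(\bullet)=1$, $\mathrm{numholes}(a[U])=\mathrm{numholes}(U)$, additive on $\parallel$, $\mathrm{numholes}(\sum_i\pi_i.U_i)=\sum_i\mathrm{numholes}(U_i)$, $\mathrm{numholes}(!\pi.U)=\mathrm{numholes}(U)$; $\mathrm{numph}(\bullet)=0$, $\mathrm{numph}(a[U])=\mathrm{numph}(U)$, additive on $\parallel$, $\mathrm{numph}(\sum_i\pi_i.U_i)=\sum_i\mathrm{numholes}(U_i)$, $\mathrm{numph}(!\pi.U)=\mathrm{numholes}(U)$.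 Writing a process up to commutativity/associativity of $\parallel$ as $\prod_i P_i\parallel\prod_j a_j[P'_j]$ ($P_i$ neither parallel nor located), $\mathrm{CStr}$ is the unordered tree with root $\epsilon$ whose children are roots of $\mathrm{CStr}(P'_j)$ relabelled $a_j$. Static semantics $\to_s$: $a[P]\xrightarrow{a[P]}\star$; $\sum_{i\in I}\pi_i.P_i\xrightarrow{\pi_j}P_j$; $!\pi.P\xrightarrow{\pi}P\parallel!\pi.P$; labels propagate through $a[\cdot]$ and either side of $\parallel$; complementary $a$, $\overline a$ in parallel components synchronise to $\tau$; if $P_1\xrightarrow{a[Q]}P_1'$, $P_2\xrightarrow{\widetilde a\{U\}}P_2'$ and $U=a[U']\parallel A$ with $\mathrm{CStr}(a[Q])=\mathrm{CStr}(a[U'\{Q\}]\parallel A)$ and ($\mathrm{numph}(U)>0\Rightarrow\mathrm{numap}(Q)=0$), then $P_1\parallel P_2\xrightarrow\tau P_1'[U\{Q\}/\star]\parallel P_2'$ (and symmetrically). $P\to P'$ means $P\xrightarrow\tau P'$. $P\downarrow_\alpha$ iff $P\xrightarrow\alpha P'$ for some $P'$; $P\Downarrow^\omega_\alpha$ iff there is an infinite computation $P\to^*Q_1\to Q_2\to\cdots$ with $Q_i\downarrow_\alpha$ for all $i$. For $M=\{P_1,\dots,P_n\}$, $\mathcal{BC}^M_P=\{P\parallel\prod^{m_1}P_1\parallel\cdots\parallel\prod^{m_n}P_n\mid m_i\in\mathbb N\}$. Eventual adaptation in $\mathcal E_s^2$: given $\mathcal E_s^2$ processes $P$ and finite $M$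 and a barb $e$, decide whether no $R\in\mathcal{BC}^M_P$ satisfies $R\Downarrow^\omega_e$. *)

theory Defs
  imports Complex_Main "HOL-Library.Multiset" "HOL-Library.Nat_Bijection"
begin

section \<open>Processes and update patterns\<close>

type_synonym name = nat

datatype 'u pref =
    In name
  | Out name
  | Upd name 'u

text \<open>
  Processes and update patterns share one type of raw terms. \<open>Hole\<close> is the hole of update
  patterns; \<open>Star\<close> is the placeholder that a located process leaves behind in the residual of
  its own transition. Neither belongs to a process, except for holes inside update prefixes.
  The family of summands of a finite sum is a list; the inactive process is the empty sum.
\<close>

datatype proc =
    Hole
  | Star
  | Loc name proc
  | Par proc proc
  | Sum "(proc pref \<times> proc) list"
  | Repl "proc pref" proc

text \<open>
  \<open>fill U Q\<close> is \<open>U{Q}\<close>: prefixes are left untouched, so holes inside update prefixes, which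
  belong to the inner pattern, are not replaced.
\<close>

fun fill :: "proc \<Rightarrow> proc \<Rightarrow> proc" where
  "fill Hole Q = Q"
| "fill Star Q = Star"
| "fill (Loc a U) Q = Loc a (fill U Q)"
| "fill (Par U V) Q = Par (fill U Q) (fill V Q)"
| "fill (Sum us) Q = Sum (map (\<lambda>(\<pi>, U). (\<pi>, fill U Q)) us)"
| "fill (Repl \<pi> U) Q = Repl \<pi> (fill U Q)"

text \<open>\<open>subst_star P X\<close> is \<open>P[X/\<star>]\<close>.\<close>

fun subst_star :: "proc \<Rightarrow> proc \<Rightarrow> proc" where
  "subst_star Hole X = Hole"
| "subst_star Star X = X"
| "subst_star (Loc a P) X = Loc a (subst_star P X)"
| "subst_star (Par P Q) X = Par (subst_star P X) (subst_star Q X)"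
| "subst_star (Sum ps) X = Sum (map (\<lambda>(\<pi>, P). (\<pi>, subst_star P X)) ps)"
| "subst_star (Repl \<pi> P) X = Repl \<pi> (subst_star P X)"

text \<open>
  The grammar of the second static fragment, with one predicate per syntactic category:
  processes \<open>P\<close>, processes \<open>A\<close> without located processes, prefixes and update patterns \<open>U\<close>.
  \<open>P ::= a[P] | P \<parallel> P | A\<close>,
  \<open>A ::= A \<parallel> A | !\<pi>.A | \<Sum>\<pi>\<^sub>i.A\<^sub>i\<close>,
  \<open>\<pi> ::= a | co-a | ~a{a[U] \<parallel> A}\<close>,
  \<open>U ::= P | a[U] | U \<parallel> U | hole\<close>.
  A pattern generated by the last clause is also a pattern over the unrestricted static
  grammar, so imposing both constraints amounts to this single grammar; the whole body
  \<open>a[U] \<parallel> A\<close> of an update prefix is generated by the last clause as well.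
\<close>

inductive Es2_proc :: "proc \<Rightarrow> bool"
  and Es2_A :: "proc \<Rightarrow> bool"
  and Es2_pref :: "proc pref \<Rightarrow> bool"
  and Es2_pat :: "proc \<Rightarrow> bool"
where
  "Es2_proc P \<Longrightarrow> Es2_proc (Loc a P)"
| "Es2_proc P \<Longrightarrow> Es2_proc Q \<Longrightarrow> Es2_proc (Par P Q)"
| "Es2_A A \<Longrightarrow> Es2_proc A"
| "Es2_A A \<Longrightarrow> Es2_A B \<Longrightarrow> Es2_A (Par A B)"
| "Es2_pref \<pi> \<Longrightarrow> Es2_A A \<Longrightarrow> Es2_A (Repl \<pi> A)"
| "(\<And>\<pi> A. (\<pi>, A) \<in> set as \<Longrightarrow> Es2_pref \<pi> \<and> Es2_A A) \<Longrightarrow> Es2_A (Sum as)"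
| "Es2_pref (In a)"
| "Es2_pref (Out a)"
| "Es2_pat U \<Longrightarrow> Es2_A A \<Longrightarrow> Es2_pref (Upd a (Par (Loc a U) A))"
| "Es2_proc P \<Longrightarrow> Es2_pat P"
| "Es2_pat U \<Longrightarrow> Es2_pat (Loc a U)"
| "Es2_pat U \<Longrightarrow> Es2_pat V \<Longrightarrow> Es2_pat (Par U V)"
| "Es2_pat Hole"

section \<open>Static semantics\<close>

fun numap :: "proc \<Rightarrow> nat" where
  "numap (Loc a U) = 1 + numap U"
| "numap (Par U V) = numap U + numap V"
| "numap Hole = 0"
| "numap Star = 0"
| "numap (Sum us) = 0"
| "numap (Repl \<pi> U) = 0"

fun numholes :: "proc \<Rightarrow> nat" where
  "numholes Hole = 1"
| "numholes Star = 0"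
| "numholes (Loc a U) = numholes U"
| "numholes (Par U V) = numholes U + numholes V"
| "numholes (Sum us) = sum_list (map (\<lambda>(\<pi>, U). numholes U) us)"
| "numholes (Repl \<pi> U) = numholes U"

fun numph :: "proc \<Rightarrow> nat" where
  "numph Hole = 0"
| "numph Star = 0"
| "numph (Loc a U) = numph U"
| "numph (Par U V) = numph U + numph V"
| "numph (Sum us) = sum_list (map (\<lambda>(\<pi>, U). numholes U) us)"
| "numph (Repl \<pi> U) = numholes U"

text \<open>Unordered trees; the label \<open>None\<close> is the root label \<open>\<epsilon>\<close>.\<close>

datatype ctree = Node "name option" "ctree multiset"

fun relabel :: "name \<Rightarrow> ctree \<Rightarrow> ctree" where
  "relabel a (Node l ts) = Node (Some a) ts"

text \<open>
  \<open>located P\<close> collects the top-level located components of \<open>P\<close>, so that \<open>CStr P\<close> depends on \<open>P\<close>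
  only up to commutativity and associativity of parallel composition.
\<close>

fun CStr :: "proc \<Rightarrow> ctree"
  and located :: "proc \<Rightarrow> ctree multiset" where
  "CStr P = Node None (located P)"
| "located (Loc a P) = {# relabel a (Node None (located P)) #}"
| "located (Par P Q) = located P + located Q"
| "located Hole = {#}"
| "located Star = {#}"
| "located (Sum ps) = {#}"
| "located (Repl \<pi> P) = {#}"

datatype act =
    Pre "proc pref"
  | Located name proc
  | Tau

inductive lts :: "proc \<Rightarrow> act \<Rightarrow> proc \<Rightarrow> bool" where
  lts_Comp: "lts (Loc a P) (Located a P) Star"
| lts_Sum: "(\<pi>, P) \<in> set ps \<Longrightarrow> lts (Sum ps) (Pre \<pi>) P"
| lts_Repl: "lts (Repl \<pi> P) (Pre \<pi>) (Par P (Repl \<pi> P))"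
| lts_Loc: "lts P \<alpha> P' \<Longrightarrow> lts (Loc a P) \<alpha> (Loc a P')"
| lts_ParL: "lts P \<alpha> P' \<Longrightarrow> lts (Par P Q) \<alpha> (Par P' Q)"
| lts_ParR: "lts Q \<alpha> Q' \<Longrightarrow> lts (Par P Q) \<alpha> (Par P Q')"
| lts_SyncL: "lts P (Pre (In a)) P' \<Longrightarrow> lts Q (Pre (Out a)) Q' \<Longrightarrow> lts (Par P Q) Tau (Par P' Q')"
| lts_SyncR: "lts P (Pre (Out a)) P' \<Longrightarrow> lts Q (Pre (In a)) Q' \<Longrightarrow> lts (Par P Q) Tau (Par P' Q')"
| lts_UpdL:
    "lts P\<^sub>1 (Located a Q) P\<^sub>1' \<Longrightarrow> lts P\<^sub>2 (Pre (Upd a U)) P\<^sub>2' \<Longrightarrow>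
     U = Par (Loc a U') A \<Longrightarrow>
     CStr (Loc a Q) = CStr (Par (Loc a (fill U' Q)) A) \<Longrightarrow>
     (numph U > 0 \<longrightarrow> numap Q = 0) \<Longrightarrow>
     lts (Par P\<^sub>1 P\<^sub>2) Tau (Par (subst_star P\<^sub>1' (fill U Q)) P\<^sub>2')"
| lts_UpdR:
    "lts P\<^sub>1 (Pre (Upd a U)) P\<^sub>1' \<Longrightarrow> lts P\<^sub>2 (Located a Q) P\<^sub>2' \<Longrightarrow>
     U = Par (Loc a U') A \<Longrightarrow>
     CStr (Loc a Q) = CStr (Par (Loc a (fill U' Q)) A) \<Longrightarrow>
     (numph U > 0 \<longrightarrow> numap Q = 0) \<Longrightarrow>
     lts (Par P\<^sub>1 P\<^sub>2) Tau (Par P\<^sub>1' (subst_star P\<^sub>2' (fill U Q)))"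

definition reduces :: "proc \<Rightarrow> proc \<Rightarrow> bool" where
  "reduces P P' \<longleftrightarrow> lts P Tau P'"

section \<open>Eventual adaptation\<close>

definition is_barb :: "proc pref \<Rightarrow> bool" where
  "is_barb \<alpha> \<longleftrightarrow> (\<exists>a. \<alpha> = In a \<or> \<alpha> = Out a)"

definition has_barb :: "proc \<Rightarrow> proc pref \<Rightarrow> bool" where
  "has_barb P \<alpha> \<longleftrightarrow> (\<exists>P'. lts P (Pre \<alpha>) P')"

definition has_barb_omega :: "proc \<Rightarrow> proc pref \<Rightarrow> bool" where
  "has_barb_omega P \<alpha> \<longleftrightarrow>
     (\<exists>Q :: nat \<Rightarrow> proc. reduces\<^sup>*\<^sup>* P (Q 0) \<and>
        (\<forall>i. reduces (Q i) (Q (Suc i)) \<and> has_barb (Q i) \<alpha>))"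

fun copies :: "nat \<Rightarrow> proc \<Rightarrow> proc" where
  "copies 0 P = Sum []"
| "copies (Suc 0) P = P"
| "copies (Suc (Suc m)) P = Par P (copies (Suc m) P)"

text \<open>The elements of \<open>M\<close> may be enumerated in any order.\<close>

definition BC :: "proc \<Rightarrow> proc set \<Rightarrow> proc set" where
  "BC P M = {foldl Par P (map2 copies ms Ps) | ms Ps.
               distinct Ps \<and> set Ps = M \<and> length ms = length Ps}"

definition eventual_adaptation :: "proc \<Rightarrow> proc set \<Rightarrow> proc pref \<Rightarrow> bool" where
  "eventual_adaptation P M e \<longleftrightarrow> \<not> (\<exists>R \<in> BC P M. has_barb_omega R e)"

section \<open>Computability\<close>

text \<open>
  Partial recursive functions: \<open>computes f xs y\<close> states that the value of \<open>f\<close> on the arguments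
  \<open>xs\<close> is defined and equal to \<open>y\<close>.
\<close>

datatype recf =
    Zero
  | Succ
  | Proj nat
  | Comp recf "recf list"
  | PrimRec recf recf
  | Mu recf

inductive computes :: "recf \<Rightarrow> nat list \<Rightarrow> nat \<Rightarrow> bool" where
  "computes Zero xs 0"
| "computes Succ [x] (Suc x)"
| "i < length xs \<Longrightarrow> computes (Proj i) xs (xs ! i)"
| "list_all2 (\<lambda>g y. computes g xs y) gs ys \<Longrightarrow> computes f ys z \<Longrightarrow> computes (Comp f gs) xs z"
| "computes f xs y \<Longrightarrow> computes (PrimRec f g) (0 # xs) y"
| "computes (PrimRec f g) (n # xs) r \<Longrightarrow> computes g (n # r # xs) y \<Longrightarrow>
     computes (PrimRec f g) (Suc n # xs) y"
| "computes f (n # xs) 0 \<Longrightarrow> (\<forall>i<n. \<exists>y. computes f (i # xs) (Suc y)) \<Longrightarrow> computes (Mu f) xs n"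

inductive_cases computes_ZeroE: "computes Zero xs y"
inductive_cases computes_SuccE: "computes Succ xs y"
inductive_cases computes_ProjE: "computes (Proj i) xs y"
inductive_cases computes_CompE: "computes (Comp f gs) xs y"
inductive_cases computes_PrimRec0E: "computes (PrimRec f g) (0 # xs) y"
inductive_cases computes_PrimRecSucE: "computes (PrimRec f g) (Suc n # xs) y"
inductive_cases computes_MuE: "computes (Mu f) xs y"

lemma computes_functional: "computes f xs y \<Longrightarrow> computes f xs z \<Longrightarrow> y = z"
proof (induction f xs y arbitrary: z rule: computes.induct)
  case (1 xs)
  then show ?case by (auto elim: computes_ZeroE)
next
  case (2 x)
  then show ?case by (auto elim: computes_SuccE)
next
  case (3 i xs)
  from "3.prems" show ?case by (rule computes_ProjE) simp
next
  case (4 xs gs ys f z)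
  from "4.prems" show ?case
  proof (rule computes_CompE)
    fix ys' assume ys': "list_all2 (\<lambda>g. computes g xs) gs ys'" "computes f ys' z"
    have "ys = ys'"
    proof (rule nth_equalityI)
      show "length ys = length ys'"
        using list_all2_lengthD[OF "4.IH"(1)] list_all2_lengthD[OF ys'(1)] by simp
      show "ys ! i = ys' ! i" if "i < length ys" for i
      proof -
        have "i < length gs"
          using that list_all2_lengthD[OF "4.IH"(1)] by simp
        from list_all2_nthD[OF "4.IH"(1) this] list_all2_nthD[OF ys'(1) this]
        show ?thesis by blast
      qed
    qed
    with ys'(2) have "computes f ys z" by simp
    then show ?thesis by (rule "4.IH"(2))
  qed
next
  case (5 f xs y g)
  from "5.prems" have "computes f xs z" by (rule computes_PrimRec0E)
  then show ?case by (rule "5.IH")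
next
  case (6 f g n xs r y)
  from "6.prems" obtain r' where r': "computes (PrimRec f g) (n # xs) r'" "computes g (n # r' # xs) z"
    by (rule computes_PrimRecSucE)
  from "6.IH"(1)[OF r'(1)] r'(2) have "computes g (n # r # xs) z" by simp
  then show ?case by (rule "6.IH"(2))
next
  case (7 f n xs)
  from "7.prems" have z: "computes f (z # xs) 0" "\<forall>i<z. \<exists>y. computes f (i # xs) (Suc y)"
    by (auto elim: computes_MuE)
  show ?case
  proof (rule linorder_cases[of n z])
    assume "n < z"
    with z(2) obtain y where "computes f (n # xs) (Suc y)" by blast
    from "7.IH"(1)[OF this] show ?thesis by simp
  next
    assume "z < n"
    with "7.IH"(2) obtain y where y: "\<forall>w. computes f (z # xs) w \<longrightarrow> Suc y = w"
      by (elim allE[of _ z] impE) auto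
    from y[rule_format, OF z(1)] show ?thesis by simp
  qed simp
qed

text \<open>
  A decision problem asks, for every instance in \<open>I\<close>, whether \<open>D\<close> holds of it. A decision
  procedure receives the code of the instance and must answer 1 or 0 accordingly; nothing is
  required of it on numbers that are not codes of instances.
\<close>

definition decidable :: "('i \<Rightarrow> nat) \<Rightarrow> 'i set \<Rightarrow> ('i \<Rightarrow> bool) \<Rightarrow> bool" where
  "decidable code I D \<longleftrightarrow> (\<exists>f. \<forall>x\<in>I. computes f [code x] (if D x then 1 else 0))"

section \<open>Coding of instances\<close>

fun code_pref :: "('u \<Rightarrow> nat) \<Rightarrow> 'u pref \<Rightarrow> nat" where
  "code_pref c (In a) = prod_encode (0, a)"
| "code_pref c (Out a) = prod_encode (1, a)"
| "code_pref c (Upd a U) = prod_encode (2, prod_encode (a, c U))"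

lemma code_pref_cong [fundef_cong]:
  "\<pi> = \<pi>' \<Longrightarrow> (\<And>U. U \<in> set_pref \<pi>' \<Longrightarrow> c U = c' U) \<Longrightarrow> code_pref c \<pi> = code_pref c' \<pi>'"
  by (cases \<pi>') auto

lemma size_set_pref [termination_simp]: "U \<in> set_pref \<pi> \<Longrightarrow> size U < size_pref size \<pi>"
  by (cases \<pi>) auto

lemma size_set_pref_Sum [termination_simp]:
  assumes "(\<pi>, P) \<in> set ps" and "U \<in> set_pref \<pi>"
  shows "size U < Suc (size_list (\<lambda>x. Suc (size_pref size (fst x) + size (snd x))) ps)"
  using size_list_estimation[OF assms(1), of "size U" "\<lambda>x. Suc (size_pref size (fst x) + size (snd x))"]
    size_set_pref[OF assms(2)] by simp

fun code_proc :: "proc \<Rightarrow> nat" where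
  "code_proc Hole = prod_encode (0, 0)"
| "code_proc Star = prod_encode (1, 0)"
| "code_proc (Loc a P) = prod_encode (2, prod_encode (a, code_proc P))"
| "code_proc (Par P Q) = prod_encode (3, prod_encode (code_proc P, code_proc Q))"
| "code_proc (Sum ps) =
     prod_encode (4, list_encode
       (map (\<lambda>(\<pi>, P). prod_encode (code_pref code_proc \<pi>, code_proc P)) ps))"
| "code_proc (Repl \<pi> P) = prod_encode (5, prod_encode (code_pref code_proc \<pi>, code_proc P))"

fun code_instance :: "proc \<times> proc list \<times> proc pref \<Rightarrow> nat" where
  "code_instance (P, Ms, e) =
     prod_encode (code_proc P,
       prod_encode (list_encode (map code_proc Ms), code_pref code_proc e))"

lemma code_pref_inj:
  "(\<And>U V. U \<in> set_pref \<pi> \<Longrightarrow> c U = c V \<Longrightarrow> U = V) \<Longrightarrow> code_pref c \<pi> = code_pref c \<pi>' \<Longrightarrow> \<pi> = \<pi>'"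
  by (cases \<pi>; cases \<pi>') auto

lemma code_proc_inj: "code_proc P = code_proc Q \<Longrightarrow> P = Q"
proof (induction P arbitrary: Q)
  case (Sum ps)
  from Sum.prems obtain qs where Q: "Q = Sum qs"
    and eq: "map (\<lambda>(\<pi>, P). prod_encode (code_pref code_proc \<pi>, code_proc P)) ps =
             map (\<lambda>(\<pi>, P). prod_encode (code_pref code_proc \<pi>, code_proc P)) qs"
    by (cases Q) (auto simp: list_encode_eq)
  have "ps = qs"
  proof (rule nth_equalityI)
    show len: "length ps = length qs"
      using eq by (metis length_map)
    show "ps ! i = qs ! i" if i: "i < length ps" for i
    proof -
      obtain \<pi> P \<pi>' P' where s: "ps ! i = (\<pi>, P)" "qs ! i = (\<pi>', P')"
        by fastforce
      have mem: "(\<pi>, P) \<in> set ps"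
        using i s(1) by (metis nth_mem)
      have "map (\<lambda>(\<pi>, P). prod_encode (code_pref code_proc \<pi>, code_proc P)) ps ! i =
            map (\<lambda>(\<pi>, P). prod_encode (code_pref code_proc \<pi>, code_proc P)) qs ! i"
        using eq by simp
      then have *: "code_pref code_proc \<pi> = code_pref code_proc \<pi>'" "code_proc P = code_proc P'"
        using i len s by auto
      have "P = P'"
        using Sum.IH(2)[OF mem] *(2) by simp
      moreover have "\<pi> = \<pi>'"
        using code_pref_inj[OF _ *(1)] Sum.IH(1)[OF mem] by simp
      ultimately show ?thesis
        using s by simp
    qed
  qed
  with Q show ?case by simp
next
  case (Repl \<pi> P)
  then show ?case
    by (cases Q) (auto dest: code_pref_inj[rotated])
next
  case Hole then show ?case by (cases Q) auto
next
  case Star then show ?case by (cases Q) auto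
next
  case (Loc a P) then show ?case by (cases Q) auto
next
  case (Par P P') then show ?case by (cases Q) auto
qed

lemma inj_code_instance: "inj code_instance"
proof (rule injI)
  fix x y assume eq: "code_instance x = code_instance y"
  obtain P Ms e P' Ms' e' where xy: "x = (P, Ms, e)" "y = (P', Ms', e')"
    by (metis prod_cases3)
  have "inj code_proc"
    by (rule injI) (rule code_proc_inj)
  moreover have "code_pref code_proc e = code_pref code_proc e'"
    using eq xy by simp
  then have "e = e'"
    by (rule code_pref_inj[rotated]) (rule code_proc_inj)
  ultimately show "x = y"
    using eq xy by (auto dest: code_proc_inj simp: list_encode_eq inj_map_eq_map)
qed

text \<open>The finite set \<open>M\<close> of an instance is presented by a list of its elements.\<close>

definition EA_instances :: "(proc \<times> proc list \<times> proc pref) set" where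
  "EA_instances = {(P, Ms, e). Es2_proc P \<and> (\<forall>Q \<in> set Ms. Es2_proc Q) \<and> is_barb e}"

fun EA :: "proc \<times> proc list \<times> proc pref \<Rightarrow> bool" where
  "EA (P, Ms, e) \<longleftrightarrow> eventual_adaptation P (set Ms) e"

end

theory Submission
  imports Defs
begin

text \<open>
  An update whose pattern has no hole resets the content of a located process, so processes
  simulate Petri nets with reset arcs, and these simulate counter machines weakly: a zero test
  resets the counter, and an erroneous one loses tokens. All tokens come from a finite supply
  of fuel, chosen by the number of copies of the only element of \<open>M\<close>; they are conserved by
  the simulation except for such losses, and handed back when the machine halts and is started
  again. As every simulated step uses up fuel, an infinite computation restarts the machine
  infinitely often; as only finitely many errors are possible, it contains a faithful halting
  computation. Conversely, a halting computation can be repeated forever with enough fuel.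

  Undecidability follows by diagonalisation, without a universal machine: from a decision
  procedure one builds a machine that runs forever if its own encoding, started on the code of
  that encoding, has an infinite computation, and that halts otherwise.
\<close>

section \<open>Recursive functions\<close>

text \<open>Self-reference is the delicate point: the encoding \<open>P\<close> of a machine must
  not mention the input, although the input is to be the code of \<open>P\<close>. The input is
  therefore loaded by one extra replicated process placed beside \<open>P\<close>. Its code depends
  only on a number \<open>n\<close>, so the code of the whole instance is an easy recursive function
  of the code of \<open>P\<close>.

  A restart has to empty every place except the fuel before it loads the input; otherwise leftovers
  of an erroneous pass would spoil the next start configuration. Fuel lies outside all locations,
  because the copies of the element of \<open>M\<close> are put in parallel at the top level.

  Terms change shape and collect inactive residues while they run, so processes are compared with
  nets through the multiset of their active components, each tagged with its location. For an update
  to act as a reset on this multiset, locations must carry distinct names, must not be nested, and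
  must not contain the update prefixes.

  The observed barb is offered permanently by a separate component, which reduces the question to
  the existence of infinite computations.\<close>

definition recursive :: "nat \<Rightarrow> (nat list \<Rightarrow> nat) \<Rightarrow> bool" where
  "recursive k F \<longleftrightarrow> (\<exists>f. \<forall>xs. length xs = k \<longrightarrow> computes f xs (F xs))"

lemma recursive_cong:
  "recursive k F \<Longrightarrow> (\<And>xs. length xs = k \<Longrightarrow> F xs = G xs) \<Longrightarrow> recursive k G"
  unfolding recursive_def by auto

lemma recursive_nth: "i < k \<Longrightarrow> recursive k (\<lambda>xs. xs ! i)"
  unfolding recursive_def by (metis computes.intros(3))

lemma recursive_comp:
  assumes "recursive (length Gs) F" and "\<forall>G\<in>set Gs. recursive k G"
  shows "recursive k (\<lambda>xs. F (map (\<lambda>G. G xs) Gs))"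
proof -
  obtain f where f: "\<And>xs. length xs = length Gs \<Longrightarrow> computes f xs (F xs)"
    using assms(1) unfolding recursive_def by blast
  obtain g where g: "\<And>G xs. G \<in> set Gs \<Longrightarrow> length xs = k \<Longrightarrow> computes (g G) xs (G xs)"
    using assms(2) unfolding recursive_def by metis
  have "computes (Comp f (map g Gs)) xs (F (map (\<lambda>G. G xs) Gs))" if "length xs = k" for xs
  proof (rule computes.intros(4))
    show "list_all2 (\<lambda>g y. computes g xs y) (map g Gs) (map (\<lambda>G. G xs) Gs)"
      using g that by (auto simp: list_all2_conv_all_nth)
  qed (simp add: f)
  then show ?thesis
    unfolding recursive_def by blast
qed

lemma recursive_comp1:
  assumes "recursive 1 (\<lambda>xs. F (xs ! 0))" and "recursive k G"
  shows "recursive k (\<lambda>xs. F (G xs))"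
  using recursive_comp[of "[G]" "\<lambda>xs. F (xs ! 0)" k] assms by simp

lemma recursive_comp2:
  assumes "recursive 2 (\<lambda>xs. F (xs ! 0) (xs ! 1))" and "recursive k G" "recursive k H"
  shows "recursive k (\<lambda>xs. F (G xs) (H xs))"
  using recursive_comp[of "[G, H]" "\<lambda>xs. F (xs ! 0) (xs ! 1)" k] assms
  by (simp add: numeral_2_eq_2)

lemma recursive_Suc:
  assumes "recursive k G"
  shows "recursive k (\<lambda>xs. Suc (G xs))"
proof (rule recursive_comp1[OF _ assms])
  show "recursive 1 (\<lambda>xs. Suc (xs ! 0))"
    unfolding recursive_def
    by (intro exI[of _ Succ]) (auto simp: length_Suc_conv intro: computes.intros(2))
qed

lemma recursive_const: "recursive k (\<lambda>_. c)"
proof (induction c)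
  case 0
  show ?case
    unfolding recursive_def using computes.intros(1) by blast
next
  case (Suc c)
  then show ?case by (rule recursive_Suc)
qed

lemma recursive_primrec:
  assumes "recursive k A" and "recursive (Suc (Suc k)) B"
  shows "recursive (Suc k) (\<lambda>xs. rec_nat (A (tl xs)) (\<lambda>n r. B (n # r # tl xs)) (hd xs))"
proof -
  obtain f where f: "\<And>xs. length xs = k \<Longrightarrow> computes f xs (A xs)"
    using assms(1) unfolding recursive_def by blast
  obtain g where g: "\<And>xs. length xs = Suc (Suc k) \<Longrightarrow> computes g xs (B xs)"
    using assms(2) unfolding recursive_def by blast
  have "computes (PrimRec f g) (n # xs) (rec_nat (A xs) (\<lambda>n r. B (n # r # xs)) n)"
    if "length xs = k" for n xs
  proof (induction n)
    case 0
    show ?case using that by (auto intro: computes.intros(5) f)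
  next
    case (Suc n)
    show ?case using that by (simp add: computes.intros(6)[OF Suc g])
  qed
  then show ?thesis
    unfolding recursive_def by (intro exI[of _ "PrimRec f g"]) (auto simp: length_Suc_conv)
qed

lemma recursive_iterate:
  assumes "recursive 2 (\<lambda>xs. B (xs ! 0) (xs ! 1))" and "recursive k G"
  shows "recursive k (\<lambda>xs. rec_nat a B (G xs))"
proof (rule recursive_comp1[OF _ assms(2)])
  have "(\<lambda>xs. rec_nat a B (hd xs)) = (\<lambda>xs. rec_nat a (\<lambda>n r. B ((n # r # tl xs) ! 0) ((n # r # tl xs) ! 1)) (hd xs))"
    by simp
  then have "recursive 1 (\<lambda>xs. rec_nat a B (hd xs))"
    using recursive_primrec[OF recursive_const[of 0 a], of "\<lambda>xs. B (xs ! 0) (xs ! 1)"] assms(1)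
    by (simp add: numeral_2_eq_2)
  then show "recursive 1 (\<lambda>xs. rec_nat a B (xs ! 0))"
    by (rule recursive_cong) (auto simp: length_Suc_conv)
qed

lemma recursive_add:
  assumes "recursive k G" "recursive k H"
  shows "recursive k (\<lambda>xs. G xs + H xs)"
proof (rule recursive_comp2[OF _ assms])
  have *: "rec_nat y (\<lambda>n. Suc) x = x + y" for x y :: nat
    by (induction x) auto
  have "recursive 3 (\<lambda>xs. Suc (xs ! 1))"
    by (intro recursive_Suc recursive_nth) simp
  with recursive_primrec[OF recursive_nth[of 0 1], of "\<lambda>xs. Suc (xs ! 1)"]
  have "recursive 2 (\<lambda>xs. rec_nat (tl xs ! 0) (\<lambda>n. Suc) (hd xs))"
    by (simp add: numeral_2_eq_2 numeral_3_eq_3)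
  then show "recursive 2 (\<lambda>xs. xs ! 0 + xs ! 1)"
    by (rule recursive_cong) (auto simp: * length_Suc_conv numeral_2_eq_2)
qed

text \<open>Needed because \<open>prod_encode\<close> is the Cantor pairing, a triangular number
  plus an offset, and all codes of processes are built from it.\<close>

lemma recursive_triangle:
  assumes "recursive k G"
  shows "recursive k (\<lambda>xs. triangle (G xs))"
proof -
  have *: "rec_nat 0 (\<lambda>n r. r + Suc n) x = triangle x" for x
    by (induction x) auto
  show ?thesis
    using recursive_iterate[of "\<lambda>n r. r + Suc n" k G 0] assms
    by (simp add: * recursive_add recursive_Suc recursive_nth del: add_Suc_right)
qed

lemma recursive_prod_encode:
  assumes "recursive k G" "recursive k H"
  shows "recursive k (\<lambda>xs. prod_encode (G xs, H xs))"
  using assms by (simp add: prod_encode_def recursive_add recursive_triangle)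

section \<open>Counter programs\<close>

text \<open>A structured language between recursive functions and machines. \<open>LOOP r c\<close>
  decrements \<open>r\<close> before each round, and \<open>c\<close> may change \<open>r\<close>
  again; unbounded search relies on this.\<close>

datatype cmd = INC nat | CLR nat | SEQ cmd cmd (infixr \<open>;;\<close> 60) | LOOP nat cmd

inductive big :: "cmd \<Rightarrow> (nat \<Rightarrow> nat) \<Rightarrow> (nat \<Rightarrow> nat) \<Rightarrow> bool" where
  big_INC: "big (INC r) \<sigma> (\<sigma>(r := Suc (\<sigma> r)))"
| big_CLR: "big (CLR r) \<sigma> (\<sigma>(r := 0))"
| big_SEQ: "big c \<sigma> \<sigma>' \<Longrightarrow> big d \<sigma>' \<sigma>'' \<Longrightarrow> big (c ;; d) \<sigma> \<sigma>''"
| big_LOOP0: "\<sigma> r = 0 \<Longrightarrow> big (LOOP r c) \<sigma> \<sigma>"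
| big_LOOPSuc: "\<sigma> r = Suc n \<Longrightarrow> big c (\<sigma>(r := n)) \<sigma>' \<Longrightarrow> big (LOOP r c) \<sigma>' \<sigma>'' \<Longrightarrow>
    big (LOOP r c) \<sigma> \<sigma>''"

text \<open>Lets unification compute a final state first; its equality with the intended one is then
  a separate goal about functions.\<close>

lemma big_eq: "big c \<sigma> \<sigma>' \<Longrightarrow> \<sigma>' = \<sigma>'' \<Longrightarrow> big c \<sigma> \<sigma>''"
  by simp

section \<open>Compiling recursive functions into counter programs\<close>

lemma big_move:
  assumes "a \<noteq> b"
  shows "big (LOOP a (INC b)) \<sigma> (\<sigma>(a := 0, b := \<sigma> b + \<sigma> a))"
proof (induction "\<sigma> a" arbitrary: \<sigma>)
  case 0
  then show ?case by (auto intro!: big_eq[OF big_LOOP0])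
next
  case (Suc n)
  show ?case
    by (rule big_eq, rule big_LOOPSuc, rule Suc(2)[symmetric], rule big_INC, rule Suc(1))
      (use assms Suc(2) in \<open>auto simp: fun_eq_iff\<close>)
qed

text \<open>Reading a register destroys it, so the value is sent to both \<open>b\<close> and the
  scratch register \<open>t\<close>, and \<open>a\<close> is restored from \<open>t\<close>.\<close>

definition COPY :: "nat \<Rightarrow> nat \<Rightarrow> nat \<Rightarrow> cmd" where
  "COPY a b t = LOOP a (INC b ;; INC t) ;; LOOP t (INC a)"

lemma big_COPY:
  assumes "a \<noteq> b" "a \<noteq> t" "b \<noteq> t" and "\<sigma> t = 0"
  shows "big (COPY a b t) \<sigma> (\<sigma>(b := \<sigma> b + \<sigma> a))"
proof -
  have *: "big (LOOP a (INC b ;; INC t)) \<sigma> (\<sigma>(a := 0, b := \<sigma> b + \<sigma> a, t := \<sigma> t + \<sigma> a))" for \<sigma>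
  proof (induction "\<sigma> a" arbitrary: \<sigma>)
    case 0
    then show ?case by (auto intro!: big_eq[OF big_LOOP0])
  next
    case (Suc n)
    show ?case
      by (rule big_eq, rule big_LOOPSuc, rule Suc(2)[symmetric], rule big_SEQ, rule big_INC,
          rule big_INC, rule Suc(1))
        (use assms Suc(2) in \<open>auto simp: fun_eq_iff\<close>)
  qed
  show ?thesis
    unfolding COPY_def
    by (rule big_eq, rule big_SEQ, rule *, rule big_move) (use assms in \<open>auto simp: fun_eq_iff\<close>)
qed

text \<open>
  \<open>compile f as out fr\<close> evaluates \<open>f\<close> on the arguments in the registers \<open>as\<close>, with result in \<open>out\<close>.
  It expects \<open>out\<close> and all scratch registers \<open>\<ge> fr\<close> to be zero, and leaves everything but \<open>out\<close>
  as it was. Where \<open>f\<close> is undefined for lack of arguments, the code is irrelevant.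
\<close>

function (sequential) compile :: "recf \<Rightarrow> nat list \<Rightarrow> nat \<Rightarrow> nat \<Rightarrow> cmd" where
  "compile Zero as out fr = CLR out"
| "compile Succ as out fr = COPY (hd as) out fr ;; INC out"
| "compile (Proj i) as out fr = COPY (as ! i) out fr"
| "compile (Comp f gs) as out fr =
     foldr (\<lambda>(g, r) c. compile g as r (fr + length gs) ;; c) (zip gs [fr..<fr + length gs])
       (compile f [fr..<fr + length gs] out (fr + length gs) ;;
        foldr (\<lambda>r c. CLR r ;; c) [fr..<fr + length gs] (CLR fr))"
| "compile (PrimRec f g) as out fr =
     COPY (hd as) fr (fr + 1) ;; compile f (tl as) out (fr + 3) ;;
     LOOP fr (compile g ((fr + 1) # out # tl as) (fr + 2) (fr + 3) ;; CLR out ;;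
       LOOP (fr + 2) (INC out) ;; INC (fr + 1)) ;;
     CLR (fr + 1)"
| "compile (Mu f) as out fr =
     compile f (out # as) fr (fr + 1) ;;
     LOOP fr (CLR fr ;; INC out ;; compile f (out # as) fr (fr + 1))"
  by pat_completeness auto
termination
  by (relation "measure (\<lambda>(f, _). size f)")
    (auto dest!: set_zip_leftD simp: less_Suc_eq_le intro: trans_le_add1 size_list_estimation')

text \<open>The argument registers lie below the fixed bound \<open>s0\<close>, while the next
  target \<open>s\<close> moves up during the induction. Each evaluation thus leaves the arguments
  intact and finds its target still zero. The first assumption packages the induction hypothesis of
  \<open>big_compile\<close>.\<close>

lemma big_foldr_compile:
  assumes "list_all2 (\<lambda>g y. \<forall>r \<sigma>. s0 \<le> r \<longrightarrow> r < fr \<longrightarrow> map \<sigma> as = xs \<longrightarrow> (\<forall>r'\<in>insert r {fr..}. \<sigma> r' = 0) \<longrightarrow>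
      big (compile g as r fr) \<sigma> (\<sigma>(r := y))) gs ys"
    and "\<forall>a\<in>set as. a < s0" "s0 \<le> s" "s + length gs = fr" "map \<sigma> as = xs" "\<forall>r\<ge>s. \<sigma> r = 0"
    and "big c (\<lambda>r. if s \<le> r \<and> r < fr then ys ! (r - s) else \<sigma> r) \<sigma>'"
  shows "big (foldr (\<lambda>(g, r) c. compile g as r fr ;; c) (zip gs [s..<fr]) c) \<sigma> \<sigma>'"
  using assms
proof (induction gs ys arbitrary: s \<sigma> rule: list_all2_induct)
  case Nil
  then show ?case by (simp cong: if_cong add: not_less[symmetric])
next
  case (Cons g gs y ys)
  have up: "[s..<fr] = s # [Suc s..<fr]"
    using Cons.prems by (simp add: upt_rec)
  have "s \<notin> set as"
    using Cons.prems by auto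
  have "big (compile g as s fr) \<sigma> (\<sigma>(s := y))"
    using Cons.hyps(1) Cons.prems by auto
  moreover have "big (foldr (\<lambda>(g, r) c. compile g as r fr ;; c) (zip gs [Suc s..<fr]) c) (\<sigma>(s := y)) \<sigma>'"
  proof (rule Cons.IH)
    show "map (\<sigma>(s := y)) as = xs"
      using Cons.prems \<open>s \<notin> set as\<close> by auto
    have "(\<lambda>r. if s \<le> r \<and> r < fr then (y # ys) ! (r - s) else \<sigma> r) =
        (\<lambda>r. if Suc s \<le> r \<and> r < fr then ys ! (r - Suc s) else (\<sigma>(s := y)) r)"
      using Cons.prems by (auto simp: fun_eq_iff nth_Cons split: nat.splits) (metis Suc_diff_Suc diff_Suc_1 le_neq_implies_less nat.simps(1))
    then show "big c (\<lambda>r. if Suc s \<le> r \<and> r < fr then ys ! (r - Suc s) else (\<sigma>(s := y)) r) \<sigma>'"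
      using Cons.prems by simp
  qed (use Cons.prems in auto)
  ultimately show ?case
    by (auto simp: up intro: big_SEQ)
qed

text \<open>The language has no skip command; the closing \<open>CLR t\<close> ends the fold
  instead, and in its use \<open>t\<close> has to be zero afterwards anyway.\<close>

lemma big_foldr_CLR:
  "big (foldr (\<lambda>r c. CLR r ;; c) rs (CLR t)) \<sigma> (\<lambda>r. if r \<in> set rs \<or> r = t then 0 else \<sigma> r)"
proof (induction rs arbitrary: \<sigma>)
  case Nil
  show ?case by (auto intro!: big_eq[OF big_CLR])
next
  case (Cons r rs)
  show ?case
    by simp (rule big_eq, rule big_SEQ, rule big_CLR, rule Cons.IH, auto)
qed

text \<open>A derivation for \<open>m\<close> contains derivations for all smaller arguments. The
  loop for primitive recursion runs through exactly these values.\<close>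

lemma computes_PrimRec_le:
  "computes (PrimRec f g) (m # xs) y \<Longrightarrow> n \<le> m \<Longrightarrow> \<exists>r. computes (PrimRec f g) (n # xs) r"
proof (induction m arbitrary: y)
  case (Suc m)
  then show ?case
    by (cases "n = Suc m") (blast, metis computes_PrimRecSucE le_SucE)
qed auto

text \<open>Only the existence of a terminating run is shown. That no other run matters will follow
  from determinism of the assembled machine.\<close>

lemma big_compile:
  assumes "computes f xs y" "map \<sigma> as = xs" "\<forall>a\<in>set as. a < fr \<and> a \<noteq> out" "out < fr"
    and "\<forall>r\<in>insert out {fr..}. \<sigma> r = 0"
  shows "big (compile f as out fr) \<sigma> (\<sigma>(out := y))"
  using assms
proof (induction f arbitrary: xs y \<sigma> as out fr)
  case Zero
  then show ?case
    by (auto elim!: computes_ZeroE intro: big_CLR simp del: fun_upd_apply)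
next
  case Succ
  from Succ.prems obtain a where a: "as = [a]" "y = Suc (\<sigma> a)"
    by (auto elim!: computes_SuccE simp: map_eq_Cons_conv)
  show ?case
    unfolding compile.simps
    by (rule big_eq[OF big_SEQ[OF big_COPY big_INC]]) (use Succ.prems a in auto)
next
  case (Proj i)
  then have i: "i < length as" "y = \<sigma> (as ! i)" "as ! i \<in> set as"
    by (auto elim!: computes_ProjE)
  then have "as ! i < fr" "as ! i \<noteq> out"
    using Proj.prems(3) by auto
  then show ?case
    unfolding compile.simps
    by (intro big_eq[OF big_COPY]) (use Proj.prems i in auto)
next
  case (Comp f gs)
  from Comp.prems(1) obtain ys where
    ys: "list_all2 (\<lambda>g y. computes g xs y) gs ys" "computes f ys y"
    by (rule computes_CompE) auto
  define e where "e = fr + length gs"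
  have len: "length ys = length gs"
    using ys(1) by (simp add: list_all2_lengthD)
  define \<sigma>' where "\<sigma>' = (\<lambda>r. if fr \<le> r \<and> r < e then ys ! (r - fr) else \<sigma> r)"
  have "big (compile f [fr..<e] out e) \<sigma>' (\<sigma>'(out := y))"
  proof (rule Comp.IH(1)[OF ys(2)])
    show "map \<sigma>' [fr..<e] = ys"
      by (rule nth_equalityI) (auto simp: \<sigma>'_def e_def len)
  qed (use Comp.prems in \<open>auto simp: \<sigma>'_def e_def\<close>)
  moreover have "big (foldr (\<lambda>r c. CLR r ;; c) [fr..<e] (CLR fr)) (\<sigma>'(out := y)) (\<sigma>(out := y))"
    by (rule big_eq[OF big_foldr_CLR]) (use Comp.prems in \<open>auto simp: \<sigma>'_def fun_eq_iff\<close>)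
  ultimately have *: "big (compile f [fr..<e] out e ;; foldr (\<lambda>r c. CLR r ;; c) [fr..<e] (CLR fr)) \<sigma>' (\<sigma>(out := y))"
    by (rule big_SEQ)
  show ?case
    unfolding compile.simps e_def[symmetric]
  proof (rule big_foldr_compile[where ?s0.0 = fr and xs = xs])
    show "list_all2 (\<lambda>g y. \<forall>r \<sigma>. fr \<le> r \<longrightarrow> r < e \<longrightarrow> map \<sigma> as = xs \<longrightarrow> (\<forall>r'\<in>insert r {e..}. \<sigma> r' = 0) \<longrightarrow>
      big (compile g as r e) \<sigma> (\<sigma>(r := y))) gs ys"
      unfolding list_all2_conv_all_nth
    proof (intro conjI allI impI)
      fix i r \<sigma>
      assume "i < length gs" and *: "fr \<le> r" "r < e" "map \<sigma> as = xs" "\<forall>r'\<in>insert r {e..}. \<sigma> r' = 0"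
      then have "gs ! i \<in> set gs" "computes (gs ! i) xs (ys ! i)"
        using ys(1) by (auto simp: list_all2_conv_all_nth)
      then show "big (compile (gs ! i) as r e) \<sigma> (\<sigma>(r := ys ! i))"
        by (rule Comp.IH(2)) (use * Comp.prems in auto)
    qed (simp add: len)
  qed (use * Comp.prems in \<open>auto simp: e_def \<sigma>'_def simp del: fun_upd_apply\<close>)
next
  case (PrimRec f g)
  from PrimRec.prems(1,2) obtain a as' where as: "as = a # as'"
    by (cases as) (auto elim: computes.cases)
  define zs where "zs = map \<sigma> as'"
  have comp: "computes (PrimRec f g) (\<sigma> a # zs) y"
    using PrimRec.prems as by (simp add: zs_def)
  have pre: "a < fr" "a \<noteq> out" "\<forall>a\<in>set as'. a < fr \<and> a \<noteq> out" "out < fr"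
    "fr \<notin> set as'" "Suc fr \<notin> set as'"
    using PrimRec.prems as by auto
  obtain r0 where r0: "computes (PrimRec f g) (0 # zs) r0"
    using computes_PrimRec_le[OF comp] by blast
  let ?body = "compile g ((fr + 1) # out # as') (fr + 2) (fr + 3) ;; CLR out ;;
       LOOP (fr + 2) (INC out) ;; INC (fr + 1)"
  \<comment> \<open>Loop invariant: \<open>fr\<close> counts the \<open>j\<close> rounds still to
    come, \<open>fr + 1\<close> holds the index \<open>n\<close> reached so far, and
    \<open>out\<close> the value at \<open>n\<close>. The next value is built in
    \<open>fr + 2\<close> because \<open>out\<close> is an argument of \<open>g\<close>.\<close>
  have loop: "big (LOOP fr ?body) \<tau> (\<tau>(fr := 0, fr + 1 := n + j, out := y))"
    if "\<tau> fr = j" "\<tau> (fr + 1) = n" "\<tau> out = r" "map \<tau> as' = zs" "\<forall>r\<ge>fr+2. \<tau> r = 0"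
      "computes (PrimRec f g) (n # zs) r" "computes (PrimRec f g) ((n + j) # zs) y" for \<tau> n r j
    using that
  proof (induction j arbitrary: \<tau> n r)
    case 0
    then have "r = y"
      using computes_functional by fastforce
    show ?case
      by (rule big_eq[OF big_LOOP0]) (use 0 \<open>r = y\<close> in auto)
  next
    case (Suc j)
    obtain r' where r': "computes (PrimRec f g) (Suc n # zs) r'"
      using computes_PrimRec_le[OF Suc.prems(7), of "Suc n"] by auto
    from r' obtain r'' where "computes (PrimRec f g) (n # zs) r''" "computes g (n # r'' # zs) r'"
      by (rule computes_PrimRecSucE)
    then have g: "computes g (n # r # zs) r'"
      using computes_functional[OF _ Suc.prems(6)] by auto
    have "big (compile g ((fr + 1) # out # as') (fr + 2) (fr + 3)) (\<tau>(fr := j)) (\<tau>(fr := j, fr + 2 := r'))"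
      by (rule PrimRec.IH(2)[OF g]) (use Suc.prems pre in auto)
    then have body: "big ?body (\<tau>(fr := j)) (\<tau>(fr := j, fr + 1 := Suc n, out := r'))"
      by (rule big_eq[OF big_SEQ[OF _ big_SEQ[OF big_CLR big_SEQ[OF big_move big_INC]]]])
        (use Suc.prems pre in \<open>auto simp: fun_eq_iff\<close>)
    have "big (LOOP fr ?body) (\<tau>(fr := j, fr + 1 := Suc n, out := r'))
      (\<tau>(fr := j, fr + 1 := Suc n, out := r', fr := 0, fr + 1 := Suc n + j, out := y))"
      by (rule Suc.IH) (use Suc.prems pre r' in auto)
    then show ?case
      by (intro big_eq[OF big_LOOPSuc[OF Suc.prems(1) body]]) (use pre in \<open>auto simp: fun_eq_iff\<close>)
  qed
  have f: "big (compile f as' out (fr + 3)) (\<sigma>(fr := \<sigma> a)) (\<sigma>(fr := \<sigma> a, out := r0))"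
  proof (rule PrimRec.IH(1))
    show "computes f zs r0"
      using r0 by (rule computes_PrimRec0E)
  qed (use PrimRec.prems as in \<open>auto simp: zs_def\<close>)
  have l: "big (LOOP fr ?body) (\<sigma>(fr := \<sigma> a, out := r0))
    (\<sigma>(fr := \<sigma> a, out := r0, fr := 0, fr + 1 := 0 + \<sigma> a, out := y))"
    by (rule loop[of _ "\<sigma> a" 0 r0]) (use PrimRec.prems as r0 comp in \<open>auto simp: zs_def\<close>)
  have "big (COPY a fr (fr + 1)) \<sigma> (\<sigma>(fr := \<sigma> a))"
    by (rule big_eq[OF big_COPY]) (use PrimRec.prems as in auto)
  from big_SEQ[OF this big_SEQ[OF f big_SEQ[OF l big_CLR]]]
  show ?case
    unfolding as compile.simps list.sel
    by (rule big_eq) (use PrimRec.prems in \<open>auto simp: fun_eq_iff\<close>)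
next
  case (Mu f)
  from Mu.prems(1) have comp: "computes f (y # xs) 0" "\<forall>i<y. \<exists>z. computes f (i # xs) (Suc z)"
    by (auto elim: computes_MuE)
  let ?c = "compile f (out # as) fr (fr + 1)"
  have eval: "big ?c (\<sigma>(out := i)) (\<sigma>(out := i, fr := z))" if "computes f (i # xs) z" for i z
    by (rule Mu.IH[OF that]) (use Mu.prems in auto)
  \<comment> \<open>Loop invariant: \<open>out\<close> holds the candidate \<open>i\<close>,
    \<open>fr\<close> the value of \<open>f\<close> at \<open>i\<close>, and \<open>j\<close> is the
    distance to the least zero \<open>y\<close>.\<close>
  have loop: "big (LOOP fr (CLR fr ;; INC out ;; ?c)) (\<sigma>(out := i, fr := z)) (\<sigma>(out := y))"
    if "i + j = y" "computes f (i # xs) z" for i j z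
    using that
  proof (induction j arbitrary: i z)
    case 0
    then have "z = 0"
      using comp(1) computes_functional by fastforce
    then show ?case
      using 0 Mu.prems by (intro big_eq[OF big_LOOP0]) (auto simp: fun_eq_iff)
  next
    case (Suc j)
    then have "i < y" by simp
    then obtain z' where "computes f (i # xs) (Suc z')"
      using comp(2) by blast
    with Suc.prems(2) have z: "z = Suc z'"
      by (rule computes_functional)
    obtain w where w: "computes f (Suc i # xs) w"
      using comp Suc.prems(1) by (metis add_Suc_shift le_add1 le_eq_less_or_eq)
    have "big (CLR fr) (\<sigma>(out := i, fr := z')) (\<sigma>(out := i))"
      by (rule big_eq[OF big_CLR]) (use Mu.prems in \<open>auto simp: fun_eq_iff\<close>)
    moreover have "big (INC out) (\<sigma>(out := i)) (\<sigma>(out := Suc i))"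
      by (rule big_eq[OF big_INC]) (auto simp: fun_eq_iff)
    ultimately have "big (CLR fr ;; INC out ;; ?c) (\<sigma>(out := i, fr := z')) (\<sigma>(out := Suc i, fr := w))"
      using eval[OF w] by (rule big_SEQ[OF _ big_SEQ])
    moreover have "big (LOOP fr (CLR fr ;; INC out ;; ?c)) (\<sigma>(out := Suc i, fr := w)) (\<sigma>(out := y))"
      by (rule Suc.IH[OF _ w]) (use Suc.prems in simp)
    ultimately show ?case
      using big_LOOPSuc[of "\<sigma>(out := i, fr := z)" fr z' _ "\<sigma>(out := Suc i, fr := w)"]
      by (simp add: z del: fun_upd_apply add: fun_upd_same)
  qed
  obtain z where "computes f (0 # xs) z"
    using comp by (metis gr0I)
  with eval[OF this] loop[of 0 y z] show ?case
    using Mu.prems by (auto intro!: big_SEQ simp: fun_upd_idem simp del: fun_upd_apply)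
qed

section \<open>Counter machines\<close>

datatype instr = IInc nat | IDec nat | IJz nat

text \<open>A conditional jump is a pair of transitions \<open>IDec r\<close> and
  \<open>IJz r\<close> with the same source, of which exactly one is enabled.\<close>

type_synonym machine = "(nat \<times> instr \<times> nat) list"

inductive mstep :: "machine \<Rightarrow> nat \<times> (nat \<Rightarrow> nat) \<Rightarrow> nat \<times> (nat \<Rightarrow> nat) \<Rightarrow> bool" for T where
  "(q, IInc r, q') \<in> set T \<Longrightarrow> mstep T (q, \<sigma>) (q', \<sigma>(r := Suc (\<sigma> r)))"
| "(q, IDec r, q') \<in> set T \<Longrightarrow> \<sigma> r = Suc n \<Longrightarrow> mstep T (q, \<sigma>) (q', \<sigma>(r := n))"
| "(q, IJz r, q') \<in> set T \<Longrightarrow> \<sigma> r = 0 \<Longrightarrow> mstep T (q, \<sigma>) (q', \<sigma>)"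

section \<open>Assembling programs into counter machines\<close>

fun len :: "cmd \<Rightarrow> nat" where
  "len (INC r) = 1"
| "len (CLR r) = 1"
| "len (c ;; d) = len c + len d"
| "len (LOOP r c) = Suc (len c)"

text \<open>\<open>assemble c i x\<close> has entry label \<open>i\<close>, exit label \<open>x\<close> and inner labels in \<open>{i..<i + len c}\<close>.\<close>

fun assemble :: "cmd \<Rightarrow> nat \<Rightarrow> nat \<Rightarrow> machine" where
  "assemble (INC r) i x = [(i, IInc r, x)]"
| "assemble (CLR r) i x = [(i, IDec r, i), (i, IJz r, x)]"
| "assemble (c ;; d) i x = assemble c i (i + len c) @ assemble d (i + len c) x"
| "assemble (LOOP r c) i x = (i, IDec r, Suc i) # (i, IJz r, x) # assemble c (Suc i) i"

lemma len_pos: "0 < len c"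
  by (induction c) auto

lemma assemble_source: "(q, a, q') \<in> set (assemble c i x) \<Longrightarrow> i \<le> q \<and> q < i + len c"
  by (induction c arbitrary: i x) (fastforce simp: len_pos)+

text \<open>Label 0 is kept free: in the net it is the state from which the input is loaded.\<close>

lemma assemble_target: "(q, a, q') \<in> set (assemble c i x) \<Longrightarrow> 0 < i \<Longrightarrow> 0 < x \<Longrightarrow> 0 < q'"
  by (induction c arbitrary: i x) fastforce+

text \<open>\<open>T\<close> only has to contain the code, so that the induction hypotheses apply to
  subprograms of a larger machine.\<close>

lemma mstep_assemble:
  assumes "big c \<sigma> \<sigma>'" and "set (assemble c i x) \<subseteq> set T"
  shows "(mstep T)\<^sup>*\<^sup>* (i, \<sigma>) (x, \<sigma>')"
  using assms
proof (induction arbitrary: i x rule: big.induct)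
  case (big_INC r \<sigma>)
  then show ?case by (auto intro: mstep.intros simp del: fun_upd_apply)
next
  case (big_CLR r \<sigma>)
  then have T: "(i, IDec r, i) \<in> set T" "(i, IJz r, x) \<in> set T" by auto
  show ?case
  proof (induction "\<sigma> r" arbitrary: \<sigma>)
    case 0
    then show ?case using mstep.intros(3)[OF T(2), of \<sigma>] by (auto simp: fun_upd_idem)
  next
    case (Suc n)
    then have "mstep T (i, \<sigma>) (i, \<sigma>(r := n))"
      using mstep.intros(2)[OF T(1)] by simp
    moreover have "(mstep T)\<^sup>*\<^sup>* (i, \<sigma>(r := n)) (x, \<sigma>(r := n, r := 0))"
      by (rule Suc(1)) simp
    ultimately show ?case by simp
  qed
next
  case (big_SEQ c \<sigma> \<sigma>' d \<sigma>'')
  from big_SEQ.IH(1)[of i "i + len c"] big_SEQ.IH(2)[of "i + len c" x] big_SEQ.prems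
  show ?case by auto
next
  case (big_LOOP0 \<sigma> r c)
  then show ?case by (auto intro: mstep.intros)
next
  case (big_LOOPSuc \<sigma> r n c \<sigma>' \<sigma>'')
  then have "mstep T (i, \<sigma>) (Suc i, \<sigma>(r := n))"
    by (auto intro!: mstep.intros(2))
  moreover have "(mstep T)\<^sup>*\<^sup>* (Suc i, \<sigma>(r := n)) (i, \<sigma>')"
    by (rule big_LOOPSuc.IH(1)) (use big_LOOPSuc.prems in auto)
  moreover have "(mstep T)\<^sup>*\<^sup>* (i, \<sigma>') (x, \<sigma>'')"
    by (rule big_LOOPSuc.IH(2)) (use big_LOOPSuc.prems in auto)
  ultimately show ?case
    by (meson converse_rtranclp_into_rtranclp rtranclp_trans)
qed

text \<open>A syntactic criterion: the only branching allowed is between a decrement and a zero test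
  of the same register, which exclude each other.\<close>

definition deterministic :: "machine \<Rightarrow> bool" where
  "deterministic T \<longleftrightarrow> (\<forall>q a p b p'. (q, a, p) \<in> set T \<longrightarrow> (q, b, p') \<in> set T \<longrightarrow>
     (a, p) = (b, p') \<or> (\<exists>r. {a, b} = {IDec r, IJz r}))"

text \<open>Different parts of a program have disjoint ranges of source labels.\<close>

lemma deterministic_assemble: "deterministic (assemble c i x)"
proof (induction c arbitrary: i x)
  case (SEQ c d)
  have "\<not> ((q, a, p) \<in> set (assemble c i (i + len c)) \<and> (q, b, p') \<in> set (assemble d (i + len c) x))" for q a p b p'
    using assemble_source[of q a p c i "i + len c"] assemble_source[of q b p' d "i + len c" x] by auto
  then show ?case
    using SEQ[unfolded deterministic_def] unfolding deterministic_def assemble.simps set_append Un_iff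
    by meson
next
  case (LOOP r c)
  have "(i, a, p) \<notin> set (assemble c (Suc i) i)" for a p
    using assemble_source[of i a p c "Suc i" i] by auto
  then show ?case
    using LOOP[unfolded deterministic_def] unfolding deterministic_def
    by (auto simp: doubleton_eq_iff)
qed (auto simp: deterministic_def)

lemma deterministic_mstep:
  assumes "deterministic T" and "mstep T s t" "mstep T s u"
  shows "t = u"
proof -
  obtain q \<sigma> where s: "s = (q, \<sigma>)" by fastforce
  have *: "(a, p) = (b, p') \<or> (\<exists>r. {a, b} = {IDec r, IJz r})"
    if "(q, a, p) \<in> set T" "(q, b, p') \<in> set T" for a b p p'
    using assms(1) that unfolding deterministic_def by blast
  show ?thesis
    using assms(2,3) unfolding s
    by (auto elim!: mstep.cases dest: * simp: doubleton_eq_iff)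
qed

definition init :: "nat \<Rightarrow> nat \<Rightarrow> nat" where
  "init n = (\<lambda>r. if r = 0 then n else 0)"

text \<open>A result is turned into halting behaviour: the appended \<open>LOOP 1 (INC 1)\<close>
  exits at once if the result in register 1 is zero, and otherwise decrements and increments that
  register forever.\<close>

lemma machine_halts_iff:
  fixes f :: recf
  obtains T h where "h > 1" "\<And>q a q'. (q, a, q') \<in> set T \<Longrightarrow> q \<noteq> 0 \<and> q \<noteq> h \<and> q' \<noteq> 0"
    "\<And>n y. computes f [n] y \<Longrightarrow> (\<exists>\<sigma>. (mstep T)\<^sup>*\<^sup>* (1, init n) (h, \<sigma>)) \<longleftrightarrow> y = 0"
proof -
  define c where "c = compile f [0] 1 2"
  \<comment> \<open>\<open>j\<close> is the entry of the final loop, which has length 2; hence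
    \<open>h\<close> is the first label after the code and has no outgoing transition.\<close>
  define j where "j = 1 + len c"
  define h where "h = j + 2"
  define T where "T = assemble (c ;; LOOP 1 (INC 1)) 1 h"
  have T: "set T = set (assemble c 1 j) \<union> {(j, IDec 1, Suc j), (j, IJz 1, h), (Suc j, IInc 1, j)}"
    by (auto simp: T_def j_def)
  have src: "q \<noteq> 0 \<and> q \<noteq> h \<and> q' \<noteq> 0" if "(q, a, q') \<in> set T" for q a q'
    using that assemble_source[of q a q' c 1 j] assemble_target[of q a q' c 1 j]
    unfolding T by (auto simp: h_def j_def)
  have det: "deterministic T"
    unfolding T_def by (rule deterministic_assemble)
  have "(\<exists>\<sigma>. (mstep T)\<^sup>*\<^sup>* (1, init n) (h, \<sigma>)) \<longleftrightarrow> y = 0" if y: "computes f [n] y" for n y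
  proof -
    have "big c (init n) ((init n)(1 := y))"
      unfolding c_def by (rule big_compile[OF y]) (auto simp: init_def)
    then have run: "(mstep T)\<^sup>*\<^sup>* (1, init n) (j, (init n)(1 := y))"
      by (rule mstep_assemble) (auto simp: T)
    show ?thesis
    proof
      assume "y = 0"
      then have "mstep T (j, (init n)(1 := y)) (h, (init n)(1 := y))"
        by (intro mstep.intros) (auto simp: T)
      then show "\<exists>\<sigma>. (mstep T)\<^sup>*\<^sup>* (1, init n) (h, \<sigma>)"
        using run by (meson rtranclp.rtrancl_into_rtrancl)
    next
      assume "\<exists>\<sigma>. (mstep T)\<^sup>*\<^sup>* (1, init n) (h, \<sigma>)"
      then obtain \<sigma> where \<sigma>: "(mstep T)\<^sup>*\<^sup>* (1, init n) (h, \<sigma>)" by blast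
      \<comment> \<open>By determinism the halting run passes through every configuration reachable
        from the start, in particular through the one at \<open>j\<close>.\<close>
      have "(mstep T)\<^sup>*\<^sup>* s (h, \<sigma>)" if "(mstep T)\<^sup>*\<^sup>* (1, init n) s" for s
        using that
      proof (induction rule: rtranclp_induct)
        case (step s t)
        from step.IH show ?case
        proof (cases rule: converse_rtranclpE)
          case base
          with step.hyps(2) src show ?thesis by (auto elim: mstep.cases)
        next
          case (step u)
          with \<open>mstep T s t\<close> show ?thesis
            using deterministic_mstep[OF det] by blast
        qed
      qed (rule \<sigma>)
      then have exit: "(mstep T)\<^sup>*\<^sup>* (j, (init n)(1 := y)) (h, \<sigma>)"
        using run by blast
      show "y = 0"
      proof (rule ccontr)
        assume "y \<noteq> 0"
        have inv: "fst s = j \<and> snd s 1 \<noteq> 0 \<or> fst s = Suc j"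
          if "(mstep T)\<^sup>*\<^sup>* (j, (init n)(1 := y)) s" for s
          using that
        proof (induction rule: rtranclp_induct)
          case (step s t)
          have "(q, a, q') \<in> set T \<Longrightarrow> q = j \<or> q = Suc j \<Longrightarrow>
              (q, a, q') \<in> {(j, IDec 1, Suc j), (j, IJz 1, h), (Suc j, IInc 1, j)}" for q a q'
            using assemble_source[of q a q' c 1 j] unfolding T by (auto simp: j_def)
          with step.hyps(2) step.IH show ?case
            by (cases rule: mstep.cases) (fastforce+)
        qed (use \<open>y \<noteq> 0\<close> in auto)
        from inv[OF exit] show False by (simp add: h_def)
      qed
    qed
  qed
  with src that[of h T] show thesis
    by (simp add: h_def j_def)
qed

section \<open>Reset nets\<close>

definition infinite_run :: "('a \<Rightarrow> 'a \<Rightarrow> bool) \<Rightarrow> 'a \<Rightarrow> bool" where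
  "infinite_run r x \<longleftrightarrow> (\<exists>f. f 0 = x \<and> (\<forall>i. r (f i) (f (Suc i))))"

lemma infinite_run_coinduct:
  assumes "P x" and "\<And>x. P x \<Longrightarrow> \<exists>y. r x y \<and> P y"
  shows "infinite_run r x"
proof -
  have "\<exists>f. \<forall>n. (P (f n) \<and> (n = 0 \<longrightarrow> f n = x)) \<and> r (f n) (f (Suc n))"
    by (rule dependent_nat_choice) (use assms in auto)
  then show ?thesis
    unfolding infinite_run_def by blast
qed

lemma infinite_run_step:
  assumes "infinite_run r x"
  shows "\<exists>y. r x y \<and> infinite_run r y"
proof -
  obtain f where f: "f 0 = x" "\<And>i. r (f i) (f (Suc i))"
    using assms unfolding infinite_run_def by blast
  have "infinite_run r (f (Suc 0))"
    unfolding infinite_run_def by (rule exI[of _ "\<lambda>i. f (Suc i)"]) (simp add: f(2))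
  with f show ?thesis by metis
qed

datatype op = Mv nat nat | Rst nat

type_synonym net = "(nat \<times> op list \<times> nat) list"

text \<open>The destination is read after the source has been decremented, so \<open>s = d\<close>
  comes out right, in agreement with the two small steps of taking and putting.\<close>

definition move :: "nat \<Rightarrow> nat \<Rightarrow> (nat \<Rightarrow> nat) \<Rightarrow> nat \<Rightarrow> nat" where
  "move s d v = (let v' = v(s := v s - 1) in v'(d := Suc (v' d)))"

lemma move_neq: "s \<noteq> d \<Longrightarrow> move s d v = v(s := v s - 1, d := Suc (v d))"
  by (simp add: move_def)

fun exec :: "op list \<Rightarrow> (nat \<Rightarrow> nat) \<Rightarrow> (nat \<Rightarrow> nat) option" where
  "exec [] v = Some v"
| "exec (Mv s d # ops) v =
     (if v s = 0 then None else exec ops (move s d v))"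
| "exec (Rst r # ops) v = exec ops (v(r := 0))"

section \<open>Atomic transitions and their small steps\<close>

inductive macro :: "net \<Rightarrow> nat \<times> (nat \<Rightarrow> nat) \<Rightarrow> nat \<times> (nat \<Rightarrow> nat) \<Rightarrow> bool" for T where
  "(q, ops, q') \<in> set T \<Longrightarrow> exec ops v = Some v' \<Longrightarrow> macro T (q, v) (q', v')"

text \<open>
  A control \<open>(mid, ops, q)\<close> still has to perform \<open>ops\<close> and then to enter state \<open>q\<close>; a
  destination in \<open>mid\<close> is owed the token that has just been taken.
\<close>

type_synonym control = "nat option \<times> op list \<times> nat"

inductive micro :: "net \<Rightarrow> control \<times> (nat \<Rightarrow> nat) \<Rightarrow> control \<times> (nat \<Rightarrow> nat) \<Rightarrow> bool" for T where
  micro_enter: "(q, ops, q') \<in> set T \<Longrightarrow> micro T ((None, [], q), v) ((None, ops, q'), v)"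
| micro_take: "0 < v s \<Longrightarrow> micro T ((None, Mv s d # ops, q), v) ((Some d, ops, q), v(s := v s - 1))"
| micro_put: "micro T ((Some d, ops, q), v) ((None, ops, q), v(d := Suc (v d)))"
| micro_reset: "micro T ((None, Rst r # ops, q), v) ((None, ops, q), v(r := 0))"

lemma micro_exec: "exec ops v = Some v' \<Longrightarrow> (micro T)\<^sup>*\<^sup>* ((None, ops, q), v) ((None, [], q), v')"
proof (induction ops v rule: exec.induct)
  case (2 s d ops v)
  let ?v = "v(s := v s - 1)"
  have "micro T ((None, Mv s d # ops, q), v) ((Some d, ops, q), ?v)"
    using 2 by (intro micro_take) (auto split: if_splits)
  moreover have "micro T ((Some d, ops, q), ?v) ((None, ops, q), move s d v)"
    unfolding move_def Let_def by (rule micro_put)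
  moreover have "(micro T)\<^sup>*\<^sup>* ((None, ops, q), move s d v) ((None, [], q), v')"
    using 2 by (auto split: if_splits)
  ultimately show ?case
    by (meson converse_rtranclp_into_rtranclp)
next
  case (3 r ops v)
  then show ?case
    using micro_reset[of T r ops q v]
    by (auto intro: converse_rtranclp_into_rtranclp simp del: fun_upd_apply)
qed auto

lemma micro_macro:
  assumes "macro T (q, v) (q', v')"
  shows "(micro T)\<^sup>+\<^sup>+ ((None, [], q), v) ((None, [], q'), v')"
  using assms
proof cases
  case (1 ops)
  then show ?thesis
    using micro_enter[of q ops q' T v] micro_exec[of ops v v' T q'] by (meson rtranclp_into_tranclp2)
qed

text \<open>The control is sequential and its next operation is determined, so a run that cannot
  complete \<open>ops\<close> is stuck and therefore finite.\<close>

lemma infinite_micro_exec: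
  "infinite_run (micro T) ((None, ops, q), v) \<Longrightarrow>
   \<exists>v'. exec ops v = Some v' \<and> infinite_run (micro T) ((None, [], q), v')"
proof (induction ops v rule: exec.induct)
  case (2 s d ops v)
  let ?v = "v(s := v s - 1)"
  from infinite_run_step[OF 2(2)] have pos: "v s > 0"
    and mid: "infinite_run (micro T) ((Some d, ops, q), ?v)"
    by (auto elim: micro.cases)
  from infinite_run_step[OF mid] have "infinite_run (micro T) ((None, ops, q), move s d v)"
    unfolding move_def Let_def by (auto elim: micro.cases)
  with pos show ?case
    using 2(1) by auto
next
  case (3 r ops v)
  from infinite_run_step[OF 3(2)] have "infinite_run (micro T) ((None, ops, q), v(r := 0))"
    by (auto elim: micro.cases simp del: fun_upd_apply)
  with 3(1) show ?case by (simp only: exec.simps)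
qed auto

lemma infinite_macro:
  assumes "infinite_run (micro T) ((None, [], q), v)"
  shows "infinite_run (macro T) (q, v)"
proof (rule infinite_run_coinduct[where P = "\<lambda>(q, v). infinite_run (micro T) ((None, [], q), v)"])
  fix x assume "case x of (q, v) \<Rightarrow> infinite_run (micro T) ((None, [], q), v)"
  then obtain q v where x: "x = (q, v)" "infinite_run (micro T) ((None, [], q), v)" by auto
  obtain ops q' where t: "(q, ops, q') \<in> set T" "infinite_run (micro T) ((None, ops, q'), v)"
    using infinite_run_step[OF x(2)] by (auto elim: micro.cases)
  from infinite_micro_exec[OF t(2)] t(1) x(1)
  show "\<exists>y. macro T x y \<and> (case y of (q, v) \<Rightarrow> infinite_run (micro T) ((None, [], q), v))"
    by (auto intro: macro.intros)
qed (use assms in simp)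

lemma infinite_run_cycle:
  assumes "r\<^sup>+\<^sup>+ x x"
  shows "infinite_run r x"
proof (rule infinite_run_coinduct[where P = "\<lambda>y. r\<^sup>*\<^sup>* y x"])
  show "\<exists>z. r y z \<and> r\<^sup>*\<^sup>* z x" if "r\<^sup>*\<^sup>* y x" for y
    using that assms by (metis converse_rtranclpE tranclpD)
qed simp

text \<open>In this direction cycles suffice, because a halting computation will be repeated from
  the very same marking.\<close>

lemma infinite_micro_cycle:
  assumes "macro T x y" "(macro T)\<^sup>*\<^sup>* y x"
  shows "infinite_run (micro T) ((None, [], fst x), snd x)"
proof (rule infinite_run_cycle)
  have 1: "(micro T)\<^sup>+\<^sup>+ ((None, [], fst x), snd x) ((None, [], fst y), snd y)"
    using assms(1) by (metis micro_macro prod.collapse)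
  have "(micro T)\<^sup>*\<^sup>* ((None, [], fst y), snd y) ((None, [], fst x), snd x)"
    using assms(2)
  proof (induction rule: rtranclp_induct)
    case (step y z)
    then show ?case
      by (metis micro_macro prod.collapse rtranclp_trans tranclp_into_rtranclp)
  qed simp
  with 1 show "(micro T)\<^sup>+\<^sup>+ ((None, [], fst x), snd x) ((None, [], fst x), snd x)"
    by (rule tranclp_rtranclp_tranclp)
qed

section \<open>Simulating a counter machine by a reset net\<close>

text \<open>
  Place 0 holds the fuel, place 1 the fuel used up by decrements and zero tests, and place
  \<open>r + 2\<close> the contents of register \<open>r\<close>. A zero test empties the register: if it was not zero,
  tokens are lost for ever.
\<close>

fun ops_of :: "instr \<Rightarrow> op list" where
  "ops_of (IInc r) = [Mv 0 (r + 2)]"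
| "ops_of (IDec r) = [Mv (r + 2) 1]"
| "ops_of (IJz r) = [Rst (r + 2), Mv 0 1]"

fun register :: "instr \<Rightarrow> nat" where
  "register (IInc r) = r"
| "register (IDec r) = r"
| "register (IJz r) = r"

text \<open>In state \<open>h\<close> any number of tokens is handed back to the fuel. The resets on
  the way to state 0 empty all other places even if collecting stopped too early; the price is a
  loss of tokens.\<close>

definition base_net :: "machine \<Rightarrow> nat \<Rightarrow> nat \<Rightarrow> net" where
  "base_net M h k = map (\<lambda>(q, a, q'). (q, ops_of a, q')) M @
     map (\<lambda>p. (h, [Mv p 0], h)) [1..<k] @ [(h, map Rst [1..<k], 0)]"

definition load :: "nat \<Rightarrow> op list" where
  "load n = replicate n (Mv 0 2)"

text \<open>The loading transition is kept apart because it alone depends on \<open>n\<close>, which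
  will be the code of a process built from \<open>base_net\<close>.\<close>

definition net_of :: "machine \<Rightarrow> nat \<Rightarrow> nat \<Rightarrow> nat \<Rightarrow> net" where
  "net_of M h k n = base_net M h k @ [(0, load n, 1)]"

definition fuel :: "nat \<Rightarrow> nat \<Rightarrow> nat" where
  "fuel m = (\<lambda>p. if p = 0 then m else 0)"

text \<open>Stated additively, since subtraction of natural numbers is truncated.\<close>

lemma sum_fun_upd:
  fixes v :: "'a \<Rightarrow> nat"
  assumes "finite A"
  shows "sum (v(s := x)) A + (if s \<in> A then v s else 0) = sum v A + (if s \<in> A then x else 0)"
proof (cases "s \<in> A")
  case True
  have "sum (v(s := x)) (A - {s}) = sum v (A - {s})"
    by (rule sum.cong) auto
  with True show ?thesis
    using sum.remove[OF assms True, of v] sum.remove[OF assms True, of "v(s := x)"] by simp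
next
  case False
  then show ?thesis by (auto intro!: sum.cong)
qed

lemma exec_Rst: "exec (map Rst rs) v = Some (\<lambda>p. if p \<in> set rs then 0 else v p)"
  by (induction rs arbitrary: v) (auto simp: fun_eq_iff)

lemma exec_load: "exec (load n) v = (if n \<le> v 0 then Some (v(0 := v 0 - n, 2 := v 2 + n)) else None)"
proof (induction n arbitrary: v)
  case (Suc n)
  have "exec (load n) (move 0 2 v) =
      (if n \<le> v 0 - 1 then Some (v(0 := v 0 - 1 - n, 2 := Suc (v 2) + n)) else None)"
    unfolding Suc by (auto simp: move_neq fun_eq_iff)
  then show ?case
    by (auto simp: load_def)
qed (simp add: load_def)

section \<open>Token accounting and correctness of the net\<close>

locale net =
  fixes M :: machine and h k n :: nat
  assumes h: "h > 1" and k: "k > 2"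
    and labels: "(q, a, q') \<in> set M \<Longrightarrow> q \<noteq> 0 \<and> q \<noteq> h \<and> q' \<noteq> 0"
    and registers: "(q, a, q') \<in> set M \<Longrightarrow> register a + 2 < k"
begin

definition total :: "(nat \<Rightarrow> nat) \<Rightarrow> nat" where
  "total v = sum v {..<k}"

definition supported :: "(nat \<Rightarrow> nat) \<Rightarrow> bool" where
  "supported v \<longleftrightarrow> (\<forall>p\<ge>k. v p = 0)"

abbreviation "N \<equiv> net_of M h k n"

lemma macro_cases:
  assumes "macro N (q, v) (q', v')"
  obtains (machine) a where "(q, a, q') \<in> set M" "exec (ops_of a) v = Some v'"
  | (collect) p where "q = h" "q' = h" "0 < p" "p < k" "0 < v p" "v' = v(p := v p - 1, 0 := Suc (v 0))"
  | (clear) "q = h" "q' = 0" "v' = (\<lambda>p. if 0 < p \<and> p < k then 0 else v p)"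
  | (restart) "q = 0" "q' = 1" "n \<le> v 0" "v' = v(0 := v 0 - n, 2 := v 2 + n)"
proof -
  from assms obtain ops where ops: "(q, ops, q') \<in> set N" "exec ops v = Some v'"
    by (auto elim: macro.cases)
  then consider a where "(q, a, q') \<in> set M" "ops = ops_of a"
    | p where "q = h" "q' = h" "0 < p" "p < k" "ops = [Mv p 0]"
    | "q = h" "q' = 0" "ops = map Rst [1..<k]"
    | "q = 0" "q' = 1" "ops = load n"
    by (auto simp: net_of_def base_net_def)
  then show thesis
  proof cases
    case 1
    with ops that(1) show ?thesis by blast
  next
    case 2
    with ops that(2)[of p] show ?thesis by (auto simp: move_neq split: if_splits)
  next
    case 3
    with ops that(3) show ?thesis by (auto simp: exec_Rst fun_eq_iff Suc_le_eq)
  next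
    case 4
    with ops that(4) show ?thesis by (auto simp: exec_load split: if_splits)
  qed
qed

lemma macro_machine:
  "(q, a, q') \<in> set M \<Longrightarrow> exec (ops_of a) v = Some v' \<Longrightarrow> macro N (q, v) (q', v')"
  by (rule macro.intros) (force simp: net_of_def base_net_def)+

lemma macro_collect:
  "0 < p \<Longrightarrow> p < k \<Longrightarrow> 0 < v p \<Longrightarrow> macro N (h, v) (h, v(p := v p - 1, 0 := Suc (v 0)))"
  by (rule macro.intros[of _ "[Mv p 0]"]) (auto simp: net_of_def base_net_def move_neq)

lemma macro_clear: "macro N (h, v) (0, \<lambda>p. if 0 < p \<and> p < k then 0 else v p)"
  by (rule macro.intros[of _ "map Rst [1..<k]"])
    (auto simp: net_of_def base_net_def exec_Rst fun_eq_iff Suc_le_eq)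

lemma macro_restart:
  "n \<le> v 0 \<Longrightarrow> macro N (0, v) (1, v(0 := v 0 - n, 2 := v 2 + n))"
  by (rule macro.intros[of _ "load n"]) (auto simp: net_of_def base_net_def exec_load)

lemma total_fun_upd: "p < k \<Longrightarrow> total (v(p := x)) + v p = total v + x"
  using sum_fun_upd[of "{..<k}" v p x] by (simp add: total_def)

lemma total_move:
  assumes "s < k" "d < k" "0 < v s" "s \<noteq> d"
  shows "total (v(s := v s - 1, d := Suc (v d))) = total v"
  using total_fun_upd[of s v "v s - 1"] total_fun_upd[of d "v(s := v s - 1)" "Suc (v d)"] assms
  by simp

lemma macro_supported: "macro N (q, v) (q', v') \<Longrightarrow> supported v \<Longrightarrow> supported v'"
proof (erule macro_cases)
  fix a assume "(q, a, q') \<in> set M" "exec (ops_of a) v = Some v'" "supported v"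
  then show "supported v'"
    using registers[of q a q'] k by (cases a) (auto simp: supported_def move_neq split: if_splits)
qed (use k in \<open>auto simp: supported_def\<close>)

text \<open>Increments and decrements move one token and are always faithful. A zero test loses
  exactly the content of the tested register, so an unchanged total certifies that the register was
  zero.\<close>

lemma machine_total:
  assumes "(q, a, q') \<in> set M" "exec (ops_of a) v = Some v'"
  shows "total v' \<le> total v"
    and "total v' = total v \<Longrightarrow> mstep M (q, \<lambda>r. v (r + 2)) (q', \<lambda>r. v' (r + 2))"
proof -
  have "total v' \<le> total v \<and> (total v' = total v \<longrightarrow> mstep M (q, \<lambda>r. v (r + 2)) (q', \<lambda>r. v' (r + 2)))"
  proof (cases a)
    case (IInc r)
    with assms have "v' = v(0 := v 0 - 1, r + 2 := Suc (v (r + 2)))" "v 0 > 0"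
      by (auto simp: move_neq split: if_splits)
    moreover from this have "total v' = total v"
      using total_move[of 0 "r + 2" v] registers[OF assms(1)] k IInc by auto
    moreover have "(\<lambda>r'. v' (r' + 2)) = (\<lambda>r. v (r + 2))(r := Suc (v (r + 2)))"
      using calculation(1) by (auto simp: fun_eq_iff)
    ultimately show ?thesis
      using mstep.intros(1)[of q r q' M "\<lambda>r. v (r + 2)"] assms IInc by simp
  next
    case (IDec r)
    with assms have "v' = v(r + 2 := v (r + 2) - 1, 1 := Suc (v 1))" "v (r + 2) > 0"
      by (auto simp: move_neq split: if_splits)
    moreover from this have "total v' = total v"
      using total_move[of "r + 2" 1 v] registers[OF assms(1)] k IDec by auto
    moreover have "(\<lambda>r'. v' (r' + 2)) = (\<lambda>r. v (r + 2))(r := v (r + 2) - 1)"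
      using calculation(1) by (auto simp: fun_eq_iff)
    ultimately show ?thesis
      using mstep.intros(2)[of q r q' M "\<lambda>r. v (r + 2)" "v (r + 2) - 1"] assms IDec by simp
  next
    case (IJz r)
    let ?w = "v(r + 2 := 0)"
    from IJz assms have v': "v' = ?w(0 := ?w 0 - 1, 1 := Suc (?w 1))" "?w 0 > 0"
      by (auto simp: move_neq split: if_splits)
    then have *: "total v' + v (r + 2) = total v"
      using total_move[of 0 1 ?w] total_fun_upd[of "r + 2" v 0] registers[OF assms(1)] k IJz by auto
    have "mstep M (q, \<lambda>r. v (r + 2)) (q', \<lambda>r. v' (r + 2))" if "v (r + 2) = 0"
    proof -
      from v'(1) that have "(\<lambda>r. v' (r + 2)) = (\<lambda>r. v (r + 2))"
        by (auto simp: fun_eq_iff)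
      then show ?thesis
        using mstep.intros(3)[of q r q' M "\<lambda>r. v (r + 2)"] assms IJz that by simp
    qed
    with * show ?thesis by auto
  qed
  then show "total v' \<le> total v"
    and "total v' = total v \<Longrightarrow> mstep M (q, \<lambda>r. v (r + 2)) (q', \<lambda>r. v' (r + 2))" by auto
qed

lemma macro_total: "macro N (q, v) (q', v') \<Longrightarrow> total v' \<le> total v"
proof (erule macro_cases)
  show "total v' \<le> total v" if "v' = (\<lambda>p. if 0 < p \<and> p < k then 0 else v p)"
    unfolding that total_def by (rule sum_mono) auto
  show "total v' \<le> total v" if "n \<le> v 0" "v' = v(0 := v 0 - n, 2 := v 2 + n)"
    using that total_fun_upd[of 0 v "v 0 - n"] total_fun_upd[of 2 "v(0 := v 0 - n)" "v 2 + n"] k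
    by auto
  show "total v' \<le> total v"
    if "0 < p" "p < k" "0 < v p" "v' = v(p := v p - 1, 0 := Suc (v 0))" for p
    using that total_move[of p 0 v] k by simp
qed (rule machine_total(1))

text \<open>Induction on the number of tokens outside the fuel. \<open>supported\<close> excludes
  tokens in places that no collecting transition reaches.\<close>

lemma collect_all: "supported v \<Longrightarrow> (macro N)\<^sup>*\<^sup>* (h, v) (h, fuel (total v))"
proof (induction "sum v {1..<k}" arbitrary: v)
  case 0
  then have "v = fuel (v 0)"
    by (auto simp: fuel_def supported_def fun_eq_iff Suc_le_eq)
  moreover have "total (fuel (v 0)) = v 0"
    using k by (simp add: total_def fuel_def)
  ultimately have "fuel (total v) = v"
    by simp
  then show ?case by simp
next
  case (Suc m)
  from Suc(2) have "\<exists>p\<in>{1..<k}. v p \<noteq> 0"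
    by (metis Zero_not_Suc sum.neutral)
  then obtain p where p: "0 < p" "p < k" "0 < v p" by (auto simp: Suc_le_eq)
  let ?v = "v(p := v p - 1, 0 := Suc (v 0))"
  have "m = sum ?v {1..<k}"
    using Suc(2) p sum_fun_upd[of "{1..<k}" v p "v p - 1"]
      sum_fun_upd[of "{1..<k}" "v(p := v p - 1)" 0 "Suc (v 0)"] by simp
  moreover have "supported ?v"
    using Suc.prems p by (auto simp: supported_def)
  ultimately have "(macro N)\<^sup>*\<^sup>* (h, ?v) (h, fuel (total ?v))"
    by (rule Suc(1))
  moreover have "total ?v = total v"
    using total_move[of p 0 v] p k by simp
  ultimately show ?case
    using macro_collect[of p v] p by (metis converse_rtranclp_into_rtranclp)
qed

text \<open>Every machine step takes at most one token from place 0, so \<open>t\<close> units of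
  fuel suffice for \<open>t\<close> steps.\<close>

lemma simulate:
  "(mstep M ^^ t) (q, \<lambda>r. v (r + 2)) (q', \<sigma>') \<Longrightarrow> t \<le> v 0 \<Longrightarrow> supported v \<Longrightarrow>
   \<exists>v'. (macro N)\<^sup>*\<^sup>* (q, v) (q', v') \<and> total v' = total v \<and> supported v'"
proof (induction t arbitrary: q v)
  case 0
  then show ?case by auto
next
  case (Suc t)
  from Suc.prems(1) obtain p \<tau> where step: "mstep M (q, \<lambda>r. v (r + 2)) (p, \<tau>)"
    and rest: "(mstep M ^^ t) (p, \<tau>) (q', \<sigma>')"
    by (metis relpowp_Suc_D2 surj_pair)
  have "\<exists>a w. (q, a, p) \<in> set M \<and> exec (ops_of a) v = Some w \<and> total w = total v \<and> t \<le> w 0 \<and> \<tau> = (\<lambda>r. w (r + 2))"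
    using step
  proof cases
    case (1 r)
    have "total (v(0 := v 0 - 1, r + 2 := Suc (v (r + 2)))) = total v"
      using total_move[of 0 "r + 2" v] registers[OF 1(2)] k Suc.prems(2) by auto
    then show ?thesis
      by (intro exI[of _ "IInc r"] exI[of _ "v(0 := v 0 - 1, r + 2 := Suc (v (r + 2)))"])
        (use 1 Suc.prems(2) in \<open>auto simp: move_neq fun_eq_iff\<close>)
  next
    case (2 r m)
    have "total (v(r + 2 := v (r + 2) - 1, 1 := Suc (v 1))) = total v"
      using total_move[of "r + 2" 1 v] registers[OF 2(2)] k 2(3) by auto
    then show ?thesis
      by (intro exI[of _ "IDec r"] exI[of _ "v(r + 2 := v (r + 2) - 1, 1 := Suc (v 1))"])
        (use 2 Suc.prems(2) in \<open>auto simp: move_neq fun_eq_iff\<close>)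
  next
    case (3 r)
    have v: "v(r + 2 := 0) = v"
      using 3(3) by (auto simp: fun_eq_iff)
    have "total (v(0 := v 0 - 1, 1 := Suc (v 1))) = total v"
      using total_move[of 0 1 v] registers[OF 3(2)] k Suc.prems(2) by auto
    then show ?thesis
      by (intro exI[of _ "IJz r"] exI[of _ "v(0 := v 0 - 1, 1 := Suc (v 1))"])
        (use 3 Suc.prems(2) v in \<open>auto simp: move_neq fun_eq_iff\<close>)
  qed
  then obtain a w where w: "(q, a, p) \<in> set M" "exec (ops_of a) v = Some w" "total w = total v" "t \<le> w 0"
    "\<tau> = (\<lambda>r. w (r + 2))" by blast
  have m: "macro N (q, v) (p, w)"
    by (rule macro_machine) fact+
  then have "supported w"
    using Suc.prems(3) by (rule macro_supported)
  with Suc.IH[of p w] rest w obtain v' where "(macro N)\<^sup>*\<^sup>* (p, w) (q', v')" "total v' = total v" "supported v'"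
    by auto
  with m show ?case by (meson converse_rtranclp_into_rtranclp)
qed

lemma infinite_run_of_halting:
  assumes "(mstep M)\<^sup>*\<^sup>* (1, init n) (h, \<sigma>)"
  shows "\<exists>m. infinite_run (micro N) ((None, [], h), fuel m)"
proof -
  obtain t where t: "(mstep M ^^ t) (1, init n) (h, \<sigma>)"
    using assms by (meson rtranclp_imp_relpowp)
  \<comment> \<open>Loading consumes \<open>n\<close> units of fuel and leaves \<open>t\<close> for
    the \<open>t\<close> machine steps. In \<open>v\<close> the input sits in place 2, which is
    register 0.\<close>
  define m where "m = n + t"
  define v where "v = (fuel m)(0 := t, 2 := n)"
  have "macro N (h, fuel m) (0, fuel m)"
  proof -
    have "(\<lambda>p. if 0 < p \<and> p < k then 0 else fuel m p) = fuel m"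
      by (auto simp: fuel_def)
    then show ?thesis
      using macro_clear[of "fuel m"] by simp
  qed
  moreover have "macro N (0, fuel m) (1, v)"
    using macro_restart[of "fuel m"] by (simp add: v_def m_def fuel_def)
  moreover have v: "(\<lambda>r. v (r + 2)) = init n" "t \<le> v 0" "supported v"
    using k by (auto simp: v_def init_def fuel_def supported_def)
  have "total v = m"
    using total_fun_upd[of 0 "fuel m" t] total_fun_upd[of 2 "(fuel m)(0 := t)" n] k
    by (simp add: v_def m_def fuel_def total_def)
  obtain w where w: "(macro N)\<^sup>*\<^sup>* (1, v) (h, w)" "total w = m" "supported w"
    using simulate[of t 1 v h \<sigma>] t v \<open>total v = m\<close> by auto
  from collect_all[OF w(3)] have "(macro N)\<^sup>*\<^sup>* (h, w) (h, fuel m)"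
    by (simp add: w)
  with w(1) have "(macro N)\<^sup>*\<^sup>* (1, v) (h, fuel m)"
    by (rule rtranclp_trans)
  ultimately have "macro N (h, fuel m) (0, fuel m)" "(macro N)\<^sup>*\<^sup>* (0, fuel m) (h, fuel m)"
    by (blast intro: converse_rtranclp_into_rtranclp)+
  from infinite_micro_cycle[OF this] show ?thesis by auto
qed

text \<open>Without a restart, either the machine keeps using up a potential made of fuel and
  registers, or the tokens left to collect run out.\<close>

lemma visits_restart:
  assumes run: "\<forall>i. macro N (g i) (g (Suc i))"
  shows "\<exists>j\<ge>i. fst (g j) = 0"
proof (rule ccontr)
  assume "\<not> (\<exists>j\<ge>i. fst (g j) = 0)"
  then have nz: "fst (g (i + j)) \<noteq> 0" for j by simp
  \<comment> \<open>Fuel weighs 2 because an increment turns it into a register token of weight 1;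
    used tokens in place 1 weigh nothing. The first component decreases on entering
    \<open>h\<close>, where only the uncollected tokens count.\<close>
  define rank where "rank = (\<lambda>(q, v :: nat \<Rightarrow> nat). (if q = h then 0 else 1 :: nat,
    if q = h then sum v {1..<k} else 2 * v 0 + sum v {2..<k}))"
  have "(rank (g (i + Suc j)), rank (g (i + j))) \<in> less_than <*lex*> less_than" for j
  proof -
    obtain q v q' v' where g: "g (i + j) = (q, v)" "g (i + Suc j) = (q', v')"
      by fastforce
    then have "macro N (q, v) (q', v')" and states: "q \<noteq> 0" "q' \<noteq> 0"
      using run[rule_format, of "i + j"] nz[of j] nz[of "Suc j"] by auto
    from this(1) show ?thesis
    proof (cases rule: macro_cases)
      case (machine a)
      note upd = sum_fun_upd[of "{2..<k}"]
      from machine(2) registers[OF machine(1)]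
      have "2 * v' 0 + sum v' {2..<k} < 2 * v 0 + sum v {2..<k}"
      proof (cases a)
        case (IInc r)
        then show ?thesis
          using machine(2) registers[OF machine(1)] upd[of v 0 "v 0 - 1"]
            upd[of "v(0 := v 0 - 1)" "r + 2" "Suc (v (r + 2))"]
          by (auto simp: move_neq split: if_splits)
      next
        case (IDec r)
        then show ?thesis
          using machine(2) registers[OF machine(1)] upd[of v "r + 2" "v (r + 2) - 1"]
            upd[of "v(r + 2 := v (r + 2) - 1)" 1 "Suc (v 1)"]
          by (auto simp: move_neq split: if_splits)
      next
        case (IJz r)
        then show ?thesis
          using machine(2) registers[OF machine(1)] upd[of v "r + 2" 0]
            upd[of "v(r + 2 := 0)" 0 "v 0 - 1"] upd[of "v(r + 2 := 0, 0 := v 0 - 1)" 1 "Suc (v 1)"]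
          by (auto simp: move_neq split: if_splits)
      qed
      with labels[OF machine(1)] g show ?thesis by (auto simp: rank_def)
    next
      case (collect p)
      then show ?thesis
        using sum_fun_upd[of "{1..<k}" v p "v p - 1"]
          sum_fun_upd[of "{1..<k}" "v(p := v p - 1)" 0 "Suc (v 0)"]
        by (simp add: rank_def g[simplified])
    qed (use states in auto)
  qed
  moreover have "wf (less_than <*lex*> less_than)"
    by auto
  ultimately show False
    unfolding wf_iff_no_infinite_down_chain not_ex by (elim allE[of _ "\<lambda>j. rank (g (i + j))"]) blast
qed

text \<open>
  Tokens are never created, so an infinite run loses tokens only finitely often. From then on
  every pass from restart to restart is a faithful halting computation.
\<close>

lemma halting_of_infinite_run:
  assumes "infinite_run (micro N) ((None, [], h), fuel m)"
  shows "\<exists>\<sigma>. (mstep M)\<^sup>*\<^sup>* (1, init n) (h, \<sigma>)"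
proof -
  obtain g where g0: "g 0 = (h, fuel m)" and run: "\<And>i. macro N (g i) (g (Suc i))"
    using infinite_macro[OF assms] unfolding infinite_run_def by blast
  have run': "macro N (fst (g i), snd (g i)) (fst (g (Suc i)), snd (g (Suc i)))" for i
    using run by simp
  have supp: "supported (snd (g i))" for i
  proof (induction i)
    case 0
    show ?case using k by (simp add: g0 supported_def fuel_def)
  next
    case (Suc i)
    then show ?case using macro_supported[OF run'] by blast
  qed
  have "decseq (\<lambda>i. total (snd (g i)))"
    by (rule decseq_SucI) (rule macro_total[OF run'])
  then have dec: "total (snd (g j)) \<le> total (snd (g i))" if "i \<le> j" for i j
    using that by (simp add: decseq_def)
  \<comment> \<open>From a moment of minimal total onwards, no token is lost.\<close>
  obtain i0 where min: "\<And>i. total (snd (g i0)) \<le> total (snd (g i))"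
    using ex_has_least_nat[of "\<lambda>_. True" 0 "\<lambda>i. total (snd (g i))"] by auto
  have const: "total (snd (g j)) = total (snd (g i0))" if "i0 \<le> j" for j
    using dec[OF that] min[of j] by simp
  \<comment> \<open>The bound \<open>Suc i0\<close> guarantees a preceding step, the one that enters
    state 0.\<close>
  obtain i where i: "i \<ge> Suc i0" "fst (g i) = 0"
    using visits_restart[of g] run by blast
  then obtain i' where i': "i = Suc i'"
    by (cases i) auto
  \<comment> \<open>State 0 is entered only by the clearing transition, so nothing but fuel is left
    there.\<close>
  have v: "snd (g i) p = 0" if "p > 0" for p
    using run'[of i']
  proof (cases rule: macro_cases)
    case clear
    then show ?thesis
      using supp[of i'] that i' by (auto simp: supported_def)
  qed (use i i' h labels in auto)
  have start: "fst (g (Suc i)) = 1" "(\<lambda>r. snd (g (Suc i)) (r + 2)) = init n"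
    using run'[of i]
  proof (atomize(full), cases rule: macro_cases)
    case restart
    then show "fst (g (Suc i)) = 1 \<and> (\<lambda>r. snd (g (Suc i)) (r + 2)) = init n"
      using v by (auto simp: init_def fun_eq_iff)
  qed (use i h labels in auto)
  \<comment> \<open>Until \<open>h\<close> is reached, the pass mirrors the machine and cannot be in
    state 0. The next visit to state 0 refutes this alternative, so a halting computation
    exists.\<close>
  have faithful: "(\<exists>\<sigma>. (mstep M)\<^sup>*\<^sup>* (1, init n) (h, \<sigma>)) \<or> fst (g (Suc i + j)) \<noteq> 0 \<and>
      (mstep M)\<^sup>*\<^sup>* (1, init n) (fst (g (Suc i + j)), \<lambda>r. snd (g (Suc i + j)) (r + 2))" for j
  proof (induction j)
    case 0
    show ?case using start by simp
  next
    case (Suc j)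
    show ?case
    proof (cases "\<exists>\<sigma>. (mstep M)\<^sup>*\<^sup>* (1, init n) (h, \<sigma>)")
      case False
      with Suc have IH: "fst (g (Suc i + j)) \<noteq> 0" "fst (g (Suc i + j)) \<noteq> h"
        "(mstep M)\<^sup>*\<^sup>* (1, init n) (fst (g (Suc i + j)), \<lambda>r. snd (g (Suc i + j)) (r + 2))"
        by auto
      have "total (snd (g (Suc (Suc i + j)))) = total (snd (g (Suc i + j)))"
        using const[of "Suc i + j"] const[of "Suc (Suc i + j)"] i(1) by simp
      with run'[of "Suc i + j"]
      have "mstep M (fst (g (Suc i + j)), \<lambda>r. snd (g (Suc i + j)) (r + 2))
          (fst (g (Suc (Suc i + j))), \<lambda>r. snd (g (Suc (Suc i + j))) (r + 2)) \<and> fst (g (Suc (Suc i + j))) \<noteq> 0"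
        by (cases rule: macro_cases) (use IH in \<open>auto dest: machine_total(2) labels\<close>)
      with IH(3) show ?thesis
        by (metis add_Suc_right rtranclp.rtrancl_into_rtrancl)
    qed simp
  qed
  obtain j where "j \<ge> Suc i" "fst (g j) = 0"
    using visits_restart[of g] run by blast
  then show ?thesis
    using faithful[of "j - Suc i"] by auto
qed

end

section \<open>Flattening processes\<close>

text \<open>
  \<open>comps w P\<close> are the unguarded sums and replications of a process located at \<open>w\<close>, tagged with
  the innermost enclosing location.
\<close>

type_synonym comp = "name option \<times> proc"

fun comps :: "name option \<Rightarrow> proc \<Rightarrow> comp multiset" where
  "comps w Hole = {#}"
| "comps w Star = {#}"
| "comps w (Loc a P) = comps (Some a) P"
| "comps w (Par P Q) = comps w P + comps w Q"
| "comps w (Sum ps) = (if ps = [] then {#} else {#(w, Sum ps)#})"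
| "comps w (Repl \<pi> P) = {#(w, Repl \<pi> P)#}"

fun locs :: "proc \<Rightarrow> name multiset" where
  "locs (Loc a P) = add_mset a (locs P)"
| "locs (Par P Q) = locs P + locs Q"
| "locs _ = {#}"

fun plain :: "proc \<Rightarrow> bool" where
  "plain (Par P Q) \<longleftrightarrow> plain P \<and> plain Q"
| "plain (Sum ps) \<longleftrightarrow> True"
| "plain (Repl \<pi> P) \<longleftrightarrow> True"
| "plain _ \<longleftrightarrow> False"

fun flat :: "proc \<Rightarrow> bool" where
  "flat (Loc a P) \<longleftrightarrow> plain P"
| "flat (Par P Q) \<longleftrightarrow> flat P \<and> flat Q"
| "flat (Sum ps) \<longleftrightarrow> True"
| "flat (Repl \<pi> P) \<longleftrightarrow> True"
| "flat _ \<longleftrightarrow> False"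

inductive act :: "proc \<Rightarrow> proc pref \<Rightarrow> proc \<Rightarrow> bool" where
  "(\<pi>, P) \<in> set ps \<Longrightarrow> act (Sum ps) \<pi> P"
| "act (Repl \<pi> P) \<pi> (Par P (Repl \<pi> P))"

text \<open>
  Update prefixes of good components stay outside all locations and replace the content of a
  location by a process without locations, so that update is a reset.
\<close>

definition good :: "comp \<Rightarrow> bool" where
  "good x \<longleftrightarrow> (\<forall>X. subst_star (snd x) X = snd x) \<and>
     (\<forall>\<pi> C. act (snd x) \<pi> C \<longrightarrow> plain C \<and>
        (\<forall>a U. \<pi> = Upd a U \<longrightarrow> fst x = None \<and>
           (\<exists>V. U = Par (Loc a V) (Sum []) \<and> plain V \<and> (\<forall>Q. fill V Q = V))))"

definition all_good :: "comp multiset \<Rightarrow> bool" where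
  "all_good K \<longleftrightarrow> (\<forall>x\<in>#K. good x)"

text \<open>The two partners of a synchronisation may have any tags, since labels cross locations.
  An update erases whatever is tagged \<open>a\<close>; its own continuation is tagged
  \<open>None\<close> and survives.\<close>

inductive fstep :: "name set \<Rightarrow> comp multiset \<Rightarrow> comp multiset \<Rightarrow> bool" for A where
  fstep_sync: "act S (In a) C \<Longrightarrow> act T (Out a) D \<Longrightarrow>
     fstep A (add_mset (w, S) (add_mset (u, T) K)) (K + comps w C + comps u D)"
| fstep_upd: "act S (Upd a (Par (Loc a V) (Sum []))) C \<Longrightarrow> a \<in> A \<Longrightarrow>
     fstep A (add_mset (None, S) K)
       (filter_mset (\<lambda>x. fst x \<noteq> Some a) K + comps None C + comps (Some a) V)"

lemma plain_flat: "plain P \<Longrightarrow> flat P"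
  by (induction P) auto

lemma plain_locs: "plain P \<Longrightarrow> locs P = {#}"
  by (induction P) auto

lemma plain_located: "plain P \<Longrightarrow> located P = {#}"
  by (induction P) auto

lemma plain_numap: "plain P \<Longrightarrow> numap P = 0"
  by (induction P) auto

lemma comps_plain: "plain P \<Longrightarrow> x \<in># comps w P \<Longrightarrow> fst x = w"
  by (induction P) (auto split: if_splits)

lemma comps_locs: "flat P \<Longrightarrow> x \<in># comps w P \<Longrightarrow> fst x = w \<or> (\<exists>a\<in>#locs P. fst x = Some a)"
  by (induction P) (auto split: if_splits dest: comps_plain)

lemma filter_comps:
  assumes "flat P" "a \<notin># locs P"
  shows "filter_mset (\<lambda>x. fst x \<noteq> Some a) (comps None P) = comps None P"
  using comps_locs[OF assms(1), of _ None] assms(2) by (fastforce simp: filter_mset_eq_conv)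

lemma all_good_simps [simp]:
  "all_good {#}" "all_good (add_mset x K) \<longleftrightarrow> good x \<and> all_good K"
  "all_good (K + L) \<longleftrightarrow> all_good K \<and> all_good L"
  by (auto simp: all_good_def)

lemma good_subst_star: "good (w, S) \<Longrightarrow> subst_star S X = S"
  by (simp add: good_def)

lemma good_act: "good (w, S) \<Longrightarrow> act S \<pi> C \<Longrightarrow> plain C"
  by (simp add: good_def)

lemma good_Upd:
  assumes "good (w, S)" "act S (Upd a U) C"
  obtains V where "w = None" "U = Par (Loc a V) (Sum [])" "plain V" "\<And>Q. fill V Q = V"
  using assms unfolding good_def by fastforce

text \<open>Hence a substitution affects only the placeholder left by the location just taken out,
  not the surrounding components.\<close>

lemma subst_star_id: "flat P \<Longrightarrow> all_good (comps w P) \<Longrightarrow> subst_star P X = P"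
proof (induction P arbitrary: w)
  case (Loc a P)
  then show ?case by (simp add: plain_flat)
next
  case (Sum ps)
  then show ?case by (cases "ps = []") (simp, metis comps.simps(5) all_good_simps(2) good_subst_star)
next
  case (Repl \<pi> P)
  then show ?case by (metis comps.simps(6) all_good_simps(2) good_subst_star)
qed auto

lemma fstep_mono: "fstep A K L \<Longrightarrow> A \<subseteq> B \<Longrightarrow> fstep B K L"
  by (erule fstep.cases) (auto intro: fstep.intros)

text \<open>The condition on tags protects the context from resets of locations in
  \<open>A\<close>.\<close>

lemma fstep_context:
  assumes "fstep A K L" and "\<forall>x\<in>#N. fst x \<notin> Some ` A"
  shows "fstep A (K + N) (L + N)" and "fstep A (N + K) (N + L)"
proof -
  show "fstep A (K + N) (L + N)"
    using assms(1)
  proof cases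
    case (fstep_sync S a C T D w u J)
    then show ?thesis
      using fstep.intros(1)[of S a C T D A w u "J + N"] by (simp add: ac_simps)
  next
    case (fstep_upd S a V C J)
    have "filter_mset (\<lambda>x. fst x \<noteq> Some a) N = N"
      using assms(2) fstep_upd(4) by (auto simp: filter_mset_eq_conv)
    then show ?thesis
      using fstep.intros(2)[of S a V C A "J + N"] fstep_upd by (simp add: ac_simps)
  qed
  then show "fstep A (N + K) (N + L)" by (simp add: add.commute)
qed

section \<open>Transitions of flat processes\<close>

lemma lts_Pre:
  assumes "lts P (Pre \<pi>) P'" "flat P" "all_good (comps w P)"
  shows "\<exists>u S K C. comps w P = add_mset (u, S) K \<and> act S \<pi> C \<and> comps w P' = K + comps u C \<and>
    flat P' \<and> locs P' = locs P \<and> (plain P \<longrightarrow> plain P')"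
  using assms
proof (induction P "Pre \<pi>" P' arbitrary: w rule: lts.induct)
  case (lts_Sum P ps)
  then have "act (Sum ps) \<pi> P" "ps \<noteq> []" by (auto intro: act.intros)
  moreover from this have "plain P"
    using lts_Sum.prems by (auto dest: good_act)
  ultimately show ?case
    by (intro exI[of _ w] exI[of _ "Sum ps"] exI[of _ "{#}"] exI[of _ P])
      (auto simp: plain_flat plain_locs)
next
  case (lts_Repl P)
  have "act (Repl \<pi> P) \<pi> (Par P (Repl \<pi> P))" by (rule act.intros)
  moreover from this have "plain P"
    using lts_Repl.prems by (auto dest: good_act)
  ultimately show ?case
    by (intro exI[of _ w] exI[of _ "Repl \<pi> P"] exI[of _ "{#}"] exI[of _ "Par P (Repl \<pi> P)"])
      (auto simp: plain_flat plain_locs)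
next
  case (lts_Loc P P' a)
  then have "plain P" by simp
  then obtain u S K C where "comps (Some a) P = add_mset (u, S) K" "act S \<pi> C"
    "comps (Some a) P' = K + comps u C" "locs P' = locs P" "plain P'"
    using lts_Loc.hyps(2)[of "Some a"] lts_Loc.prems by (auto simp: plain_flat)
  then show ?case by auto
next
  case (lts_ParL P P' Q)
  then obtain u S K C where *: "comps w P = add_mset (u, S) K" "act S \<pi> C"
    "comps w P' = K + comps u C" "flat P'" "locs P' = locs P" "plain P \<longrightarrow> plain P'"
    using lts_ParL.hyps(2)[of w] lts_ParL.prems by (simp, blast)
  show ?case
    by (rule exI[of _ u], rule exI[of _ S], rule exI[of _ "K + comps w Q"], rule exI[of _ C])
      (use * lts_ParL.prems in \<open>auto simp: ac_simps\<close>)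
next
  case (lts_ParR Q Q' P)
  then obtain u S K C where *: "comps w Q = add_mset (u, S) K" "act S \<pi> C"
    "comps w Q' = K + comps u C" "flat Q'" "locs Q' = locs Q" "plain Q \<longrightarrow> plain Q'"
    using lts_ParR.hyps(2)[of w] lts_ParR.prems by (simp, blast)
  show ?case
    by (rule exI[of _ u], rule exI[of _ S], rule exI[of _ "comps w P + K"], rule exI[of _ C])
      (use * lts_ParR.prems in \<open>auto simp: ac_simps\<close>)
qed

lemma lts_Pre_ex:
  assumes "comps w P = add_mset (u, S) K" "act S \<pi> C" "flat P" "plain C"
  shows "\<exists>P'. lts P (Pre \<pi>) P' \<and> comps w P' = K + comps u C \<and>
    flat P' \<and> locs P' = locs P \<and> (plain P \<longrightarrow> plain P')"
  using assms
proof (induction P arbitrary: w K)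
  case (Loc a P)
  then have "plain P" by simp
  with Loc.IH[of "Some a" K] Loc.prems obtain P' where
    "lts P (Pre \<pi>) P'" "comps (Some a) P' = K + comps u C" "locs P' = locs P" "plain P'"
    by (auto simp: plain_flat)
  then show ?case
    by (intro exI[of _ "Loc a P'"]) (auto intro: lts_Loc)
next
  case (Par P Q)
  from Par.prems(1) have "(u, S) \<in># comps w P + comps w Q" by simp
  then consider "(u, S) \<in># comps w P" | "(u, S) \<in># comps w Q" by auto
  then show ?case
  proof cases
    case 1
    then obtain J where J: "comps w P = add_mset (u, S) J" by (rule mset_add)
    with Par.IH(1)[of w J] Par.prems obtain P' where
      "lts P (Pre \<pi>) P'" "comps w P' = J + comps u C" "flat P'" "locs P' = locs P" "plain P \<longrightarrow> plain P'"
      by auto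
    then show ?thesis
      using J Par.prems by (intro exI[of _ "Par P' Q"]) (auto intro: lts_ParL simp: ac_simps)
  next
    case 2
    then obtain J where J: "comps w Q = add_mset (u, S) J" by (rule mset_add)
    with Par.IH(2)[of w J] Par.prems obtain Q' where
      "lts Q (Pre \<pi>) Q'" "comps w Q' = J + comps u C" "flat Q'" "locs Q' = locs Q" "plain Q \<longrightarrow> plain Q'"
      by auto
    then show ?thesis
      using J Par.prems by (intro exI[of _ "Par P Q'"]) (auto intro: lts_ParR simp: ac_simps)
  qed
next
  case (Sum ps)
  then show ?case
    by (auto elim!: act.cases intro!: exI[of _ C] lts_Sum simp: plain_flat plain_locs split: if_splits)
next
  case (Repl \<rho> P)
  then show ?case
    by (auto elim!: act.cases intro!: exI[of _ C] lts_Repl simp: plain_flat plain_locs)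
qed auto

section \<open>Updates as resets\<close>

lemma lts_Located_plain: "lts P (Located a Q) P' \<Longrightarrow> \<not> plain P"
  by (induction P "Located a Q" P' rule: lts.induct) auto

text \<open>The residual contains \<open>Star\<close> and is not flat, so it is described through
  all its instances \<open>subst_star P' X\<close>. Given distinct names, the last conjunct will
  show that nothing in \<open>K\<close> is tagged \<open>a\<close>.\<close>

lemma lts_Located:
  assumes "lts P (Located a Q) P'" "flat P" "all_good (comps None P)"
  shows "plain Q \<and> a \<in># locs P \<and> (\<exists>K. comps None P = K + comps (Some a) Q \<and>
    (\<forall>X. comps None (subst_star P' X) = K + comps None X) \<and>
    (\<forall>X. locs (subst_star P' X) + {#a#} = locs P + locs X) \<and>
    (\<forall>X. flat X \<longrightarrow> flat (subst_star P' X)) \<and>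
    (\<forall>x\<in>#K. fst x = None \<or> (\<exists>b\<in>#locs P - {#a#}. fst x = Some b)))"
  using assms
proof (induction P "Located a Q" P' rule: lts.induct)
  case lts_Comp
  then show ?case by (auto simp: plain_locs)
next
  case (lts_Loc P P' b)
  then show ?case using lts_Located_plain by auto
next
  case (lts_ParL P P' R)
  then obtain K where *: "plain Q" "a \<in># locs P" "comps None P = K + comps (Some a) Q"
    "\<And>X. comps None (subst_star P' X) = K + comps None X"
    "\<And>X. locs (subst_star P' X) + {#a#} = locs P + locs X"
    "\<And>X. flat X \<Longrightarrow> flat (subst_star P' X)"
    "\<forall>x\<in>#K. fst x = None \<or> (\<exists>b\<in>#locs P - {#a#}. fst x = Some b)"
    by auto
  have R: "subst_star R X = R" for X
    by (rule subst_star_id[of _ None]) (use lts_ParL.prems in auto)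
  have "flat R" using lts_ParL.prems by simp
  have "locs P + locs R - {#a#} = (locs P - {#a#}) + locs R"
    using *(2) by simp
  then have "\<forall>x\<in>#K + comps None R. fst x = None \<or> (\<exists>b\<in>#locs P + locs R - {#a#}. fst x = Some b)"
    using *(7) comps_locs[OF \<open>flat R\<close>, of _ None] by auto
  moreover have "locs (subst_star P' X) + locs R + {#a#} = locs P + locs R + locs X" for X
    using *(5)[of X] by (metis add.assoc add.commute)
  ultimately show ?case
    using *(1-4,6) R \<open>flat R\<close>
    by (intro conjI exI[of _ "K + comps None R"]) (auto simp: ac_simps)
next
  case (lts_ParR R R' P)
  then obtain K where *: "plain Q" "a \<in># locs R" "comps None R = K + comps (Some a) Q"
    "\<And>X. comps None (subst_star R' X) = K + comps None X"
    "\<And>X. locs (subst_star R' X) + {#a#} = locs R + locs X"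
    "\<And>X. flat X \<Longrightarrow> flat (subst_star R' X)"
    "\<forall>x\<in>#K. fst x = None \<or> (\<exists>b\<in>#locs R - {#a#}. fst x = Some b)"
    by auto
  have P: "subst_star P X = P" for X
    by (rule subst_star_id[of _ None]) (use lts_ParR.prems in auto)
  have "flat P" using lts_ParR.prems by simp
  have "locs P + locs R - {#a#} = locs P + (locs R - {#a#})"
    using *(2) by simp
  then have "\<forall>x\<in>#K + comps None P. fst x = None \<or> (\<exists>b\<in>#locs P + locs R - {#a#}. fst x = Some b)"
    using *(7) comps_locs[OF \<open>flat P\<close>, of _ None] by auto
  moreover have "locs P + locs (subst_star R' X) + {#a#} = locs P + locs R + locs X" for X
    using *(5)[of X] by (metis add.assoc)
  ultimately show ?case
    using *(1-4,6) P \<open>flat P\<close>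
    by (intro conjI exI[of _ "K + comps None P"]) (auto simp: ac_simps)
qed

lemma lts_Located_ex: "a \<in># locs P \<Longrightarrow> flat P \<Longrightarrow> \<exists>Q P'. lts P (Located a Q) P'"
  by (induction P) (auto intro: lts.intros simp: plain_locs)

definition distinct_locs :: "proc \<Rightarrow> bool" where
  "distinct_locs P \<longleftrightarrow> (\<forall>a. count (locs P) a \<le> 1)"

lemma distinct_locs_Par:
  assumes "distinct_locs (Par P Q)"
  shows "distinct_locs P" "distinct_locs Q" "a \<in># locs P \<Longrightarrow> a \<notin># locs Q"
proof -
  have *: "count (locs P) a + count (locs Q) a \<le> 1" for a
    using assms by (simp add: distinct_locs_def)
  show "distinct_locs P" "distinct_locs Q"
    unfolding distinct_locs_def using * by (meson add_leD1 add_leD2)+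
  show "a \<in># locs P \<Longrightarrow> a \<notin># locs Q"
    using *[of a] by (simp add: not_in_iff flip: count_greater_zero_iff)
qed

text \<open>As names are distinct, the components tagged \<open>a\<close> are exactly those of the
  removed content \<open>Q\<close>; replacing \<open>Q\<close> is the same as filtering.\<close>

lemma lts_Located_reset:
  assumes "lts P (Located a Q) P'" "flat P" "all_good (comps None P)" "distinct_locs P" "plain V"
  shows "plain Q" "a \<in># locs P" "flat (subst_star P' (Par (Loc a V) (Sum [])))"
    "locs (subst_star P' (Par (Loc a V) (Sum []))) = locs P"
    "comps None (subst_star P' (Par (Loc a V) (Sum []))) =
       filter_mset (\<lambda>x. fst x \<noteq> Some a) (comps None P) + comps (Some a) V"
proof -
  obtain K where *: "plain Q" "a \<in># locs P" "comps None P = K + comps (Some a) Q"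
    "\<And>X. comps None (subst_star P' X) = K + comps None X"
    "\<And>X. locs (subst_star P' X) + {#a#} = locs P + locs X"
    "\<And>X. flat X \<Longrightarrow> flat (subst_star P' X)"
    "\<forall>x\<in>#K. fst x = None \<or> (\<exists>b\<in>#locs P - {#a#}. fst x = Some b)"
    using lts_Located[OF assms(1-3)] by blast
  show "plain Q" "a \<in># locs P" by fact+
  show "flat (subst_star P' (Par (Loc a V) (Sum [])))"
    using *(6) assms(5) by simp
  show "locs (subst_star P' (Par (Loc a V) (Sum []))) = locs P"
    using *(5)[of "Par (Loc a V) (Sum [])"] plain_locs[OF assms(5)] by simp
  have "count (locs P - {#a#}) a = 0"
    using assms(4) by (simp add: distinct_locs_def)
  then have "a \<notin># locs P - {#a#}"
    by (simp add: not_in_iff)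
  then have "filter_mset (\<lambda>x. fst x \<noteq> Some a) K = K"
    using *(7) by (fastforce simp: filter_mset_eq_conv)
  moreover have "filter_mset (\<lambda>x. fst x \<noteq> Some a) (comps (Some a) Q) = {#}"
    using comps_plain[OF *(1)] by (fastforce simp: filter_mset_eq_conv)
  ultimately show "comps None (subst_star P' (Par (Loc a V) (Sum []))) =
       filter_mset (\<lambda>x. fst x \<noteq> Some a) (comps None P) + comps (Some a) V"
    using *(3,4) by simp
qed

lemma lts_Upd:
  assumes "lts P (Located a Q) P'" "flat P" "all_good (comps None P)" "distinct_locs P"
    and "lts R (Pre (Upd a U)) R'" "flat R" "all_good (comps None R)" "a \<notin># locs R"
  shows "\<exists>S V C K. comps None R = add_mset (None, S) K \<and> act S (Upd a (Par (Loc a V) (Sum []))) C \<and>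
    comps None (subst_star P' (fill U Q)) + comps None R' =
      filter_mset (\<lambda>x. fst x \<noteq> Some a) (comps None P + K) + comps None C + comps (Some a) V \<and>
    flat (subst_star P' (fill U Q)) \<and> flat R' \<and> locs (subst_star P' (fill U Q)) = locs P \<and> locs R' = locs R"
proof -
  obtain u S K C where R: "comps None R = add_mset (u, S) K" "act S (Upd a U) C"
    "comps None R' = K + comps u C" "flat R'" "locs R' = locs R"
    using lts_Pre[OF assms(5-7)] by blast
  then have "good (u, S)"
    using assms(7) by simp
  from good_Upd[OF this R(2)] obtain V where V: "u = None" "U = Par (Loc a V) (Sum [])"
    "plain V" "fill V Q = V" by metis
  note reset = lts_Located_reset[OF assms(1-4) V(3)]
  have K: "filter_mset (\<lambda>x. fst x \<noteq> Some a) K = K"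
    using filter_comps[OF assms(6,8)] R(1) V(1) by simp
  have "fill U Q = Par (Loc a V) (Sum [])"
    using V by simp
  then show ?thesis
    using R V reset K by (intro exI[of _ S] exI[of _ V] exI[of _ C] exI[of _ K]) (simp add: ac_simps)
qed

text \<open>The tag \<open>w\<close> is arbitrary because the induction descends into locations.
  Inside them the process is plain and offers no location, so updates arise only for
  \<open>w = None\<close>.\<close>

lemma lts_Tau:
  assumes "lts P Tau P'" "flat P" "all_good (comps w P)" "distinct_locs P" "w = None \<or> plain P"
  shows "fstep (set_mset (locs P)) (comps w P) (comps w P') \<and> flat P' \<and> locs P' = locs P \<and>
    (plain P \<longrightarrow> plain P')"
  using assms
proof (induction P Tau P' arbitrary: w rule: lts.induct)
  case (lts_Loc P P' a)
  then have P: "flat P" "plain P" "all_good (comps (Some a) P)" "distinct_locs P"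
    by (auto simp: plain_flat plain_locs distinct_locs_def)
  with lts_Loc.hyps(2)[of "Some a"] have
    "fstep (set_mset (locs P)) (comps (Some a) P) (comps (Some a) P')" "plain P'" "locs P' = locs P"
    by auto
  then show ?case
    by (auto intro: fstep_mono)
next
  case (lts_ParL P P' Q)
  note d = distinct_locs_Par[OF lts_ParL.prems(3)]
  have IH: "fstep (set_mset (locs P)) (comps w P) (comps w P')" "flat P'" "locs P' = locs P"
    "plain P \<longrightarrow> plain P'"
    using lts_ParL.hyps(2)[of w] lts_ParL.prems d by auto
  have "\<forall>x\<in>#comps w Q. fst x \<notin> Some ` set_mset (locs P)"
    using lts_ParL.prems(1,4) d(3) comps_locs[of Q _ w] by (fastforce simp: plain_locs)
  from fstep_context(1)[OF IH(1) this] IH(2-4) lts_ParL.prems(1) show ?case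
    by (auto intro: fstep_mono)
next
  case (lts_ParR Q Q' P)
  note d = distinct_locs_Par[OF lts_ParR.prems(3)]
  have IH: "fstep (set_mset (locs Q)) (comps w Q) (comps w Q')" "flat Q'" "locs Q' = locs Q"
    "plain Q \<longrightarrow> plain Q'"
    using lts_ParR.hyps(2)[of w] lts_ParR.prems d by auto
  have "\<forall>x\<in>#comps w P. fst x \<notin> Some ` set_mset (locs Q)"
    using lts_ParR.prems(1,4) d(3) comps_locs[of P _ w] by (fastforce simp: plain_locs)
  from fstep_context(2)[OF IH(1) this] IH(2-4) lts_ParR.prems(1) show ?case
    by (auto intro: fstep_mono)
next
  case (lts_SyncL P a P' Q Q')
  obtain u S K C where P: "comps w P = add_mset (u, S) K" "act S (In a) C"
    "comps w P' = K + comps u C" "flat P'" "locs P' = locs P" "plain P \<longrightarrow> plain P'"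
    using lts_Pre[OF lts_SyncL.hyps(1), of w] lts_SyncL.prems by (simp, blast)
  obtain t T J D where Q: "comps w Q = add_mset (t, T) J" "act T (Out a) D"
    "comps w Q' = J + comps t D" "flat Q'" "locs Q' = locs Q" "plain Q \<longrightarrow> plain Q'"
    using lts_Pre[OF lts_SyncL.hyps(2), of w] lts_SyncL.prems by (simp, blast)
  from fstep_sync[OF P(2) Q(2), of _ u t "K + J"] P Q show ?case
    by (simp add: ac_simps)
next
  case (lts_SyncR P a P' Q Q')
  obtain u S K C where P: "comps w P = add_mset (u, S) K" "act S (Out a) C"
    "comps w P' = K + comps u C" "flat P'" "locs P' = locs P" "plain P \<longrightarrow> plain P'"
    using lts_Pre[OF lts_SyncR.hyps(1), of w] lts_SyncR.prems by (simp, blast)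
  obtain t T J D where Q: "comps w Q = add_mset (t, T) J" "act T (In a) D"
    "comps w Q' = J + comps t D" "flat Q'" "locs Q' = locs Q" "plain Q \<longrightarrow> plain Q'"
    using lts_Pre[OF lts_SyncR.hyps(2), of w] lts_SyncR.prems by (simp, blast)
  from fstep_sync[OF Q(2) P(2), of _ t u "K + J"] P Q show ?case
    by (simp add: ac_simps add_mset_commute)
next
  case (lts_UpdL P a Q P' R U R' U' A)
  have np: "\<not> plain P"
    using lts_Located_plain[OF lts_UpdL.hyps(1)] .
  with lts_UpdL.prems have [simp]: "w = None" by simp
  note d = distinct_locs_Par[OF lts_UpdL.prems(3)]
  have prems: "flat P" "flat R" "all_good (comps None P)" "all_good (comps None R)"
    using lts_UpdL.prems by auto
  have a: "a \<in># locs P"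
    using lts_Located[OF lts_UpdL.hyps(1) prems(1,3)] by simp
  obtain S V C K where *: "comps None R = add_mset (None, S) K" "act S (Upd a (Par (Loc a V) (Sum []))) C"
    "comps None (subst_star P' (fill U Q)) + comps None R' =
      filter_mset (\<lambda>x. fst x \<noteq> Some a) (comps None P + K) + comps None C + comps (Some a) V"
    "flat (subst_star P' (fill U Q))" "flat R'" "locs (subst_star P' (fill U Q)) = locs P" "locs R' = locs R"
    using lts_Upd[OF lts_UpdL.hyps(1) prems(1,3) d(1) lts_UpdL.hyps(2) prems(2,4) d(3)[OF a]] by blast
  have "fstep (set_mset (locs (Par P R))) (add_mset (None, S) (comps None P + K))
      (comps None (subst_star P' (fill U Q)) + comps None R')"
    unfolding *(3) by (rule fstep_upd[OF *(2)]) (use a in simp)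
  with * np show ?case by simp
next
  case (lts_UpdR R a U R' P Q P' U' A)
  have np: "\<not> plain P"
    using lts_Located_plain[OF lts_UpdR.hyps(2)] .
  with lts_UpdR.prems have [simp]: "w = None" by simp
  note d = distinct_locs_Par[OF lts_UpdR.prems(3)]
  have prems: "flat P" "flat R" "all_good (comps None P)" "all_good (comps None R)"
    using lts_UpdR.prems by auto
  have a: "a \<in># locs P"
    using lts_Located[OF lts_UpdR.hyps(2) prems(1,3)] by simp
  then have "a \<notin># locs R"
    using d(3) by blast
  then obtain S V C K where *: "comps None R = add_mset (None, S) K" "act S (Upd a (Par (Loc a V) (Sum []))) C"
    "comps None (subst_star P' (fill U Q)) + comps None R' =
      filter_mset (\<lambda>x. fst x \<noteq> Some a) (comps None P + K) + comps None C + comps (Some a) V"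
    "flat (subst_star P' (fill U Q))" "flat R'" "locs (subst_star P' (fill U Q)) = locs P" "locs R' = locs R"
    using lts_Upd[OF lts_UpdR.hyps(2) prems(1,3) d(2) lts_UpdR.hyps(1) prems(2,4)] by blast
  have "fstep (set_mset (locs (Par R P))) (add_mset (None, S) (comps None P + K))
      (comps None (subst_star P' (fill U Q)) + comps None R')"
    unfolding *(3) by (rule fstep_upd[OF *(2)]) (use a in simp)
  with * np show ?case by (simp add: add.commute)
qed

text \<open>Descends to the parallel composition that separates the two partners, where a
  synchronisation rule applies.\<close>

lemma lts_sync_ex:
  assumes "comps w P = add_mset (u, S) (add_mset (t, T) K)" "act S (In a) C" "act T (Out a) D"
    and "flat P" "plain C" "plain D"
  shows "\<exists>P'. lts P Tau P' \<and> comps w P' = K + comps u C + comps t D \<and>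
    flat P' \<and> locs P' = locs P \<and> (plain P \<longrightarrow> plain P')"
  using assms
proof (induction P arbitrary: w K)
  case (Loc b P)
  then have "plain P" by simp
  with Loc.IH[of "Some b" K] Loc.prems obtain P' where
    "lts P Tau P'" "comps (Some b) P' = K + comps u C + comps t D" "locs P' = locs P" "plain P'"
    by (auto simp: plain_flat)
  then show ?case
    by (intro exI[of _ "Loc b P'"]) (auto intro: lts_Loc)
next
  case (Par P Q)
  have flat: "flat P" "flat Q" using Par.prems by auto
  have eq: "comps w P + comps w Q = add_mset (u, S) (add_mset (t, T) K)"
    using Par.prems by simp
  then have "(u, S) \<in># comps w P \<or> (u, S) \<in># comps w Q"
    by (metis union_iff union_single_eq_member)
  then show ?case
  proof
    assume "(u, S) \<in># comps w P"
    then obtain J where J: "comps w P = add_mset (u, S) J" by (rule mset_add)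
    with eq have eq': "J + comps w Q = add_mset (t, T) K" by simp
    then have "(t, T) \<in># J \<or> (t, T) \<in># comps w Q"
      by (metis union_iff union_single_eq_member)
    then show ?thesis
    proof
      assume "(t, T) \<in># J"
      then obtain L where L: "J = add_mset (t, T) L" by (rule mset_add)
      with J Par.IH(1)[of w L] Par.prems flat obtain P' where
        "lts P Tau P'" "comps w P' = L + comps u C + comps t D" "flat P'" "locs P' = locs P"
        "plain P \<longrightarrow> plain P'" by auto
      with L eq' flat show ?thesis
        by (intro exI[of _ "Par P' Q"]) (auto intro: lts_ParL simp: ac_simps)
    next
      assume "(t, T) \<in># comps w Q"
      then obtain L where L: "comps w Q = add_mset (t, T) L" by (rule mset_add)
      obtain P' where P': "lts P (Pre (In a)) P'" "comps w P' = J + comps u C" "flat P'" "locs P' = locs P"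
        "plain P \<longrightarrow> plain P'"
        using lts_Pre_ex[OF J Par.prems(2) flat(1) Par.prems(5)] by blast
      obtain Q' where Q': "lts Q (Pre (Out a)) Q'" "comps w Q' = L + comps t D" "flat Q'" "locs Q' = locs Q"
        "plain Q \<longrightarrow> plain Q'"
        using lts_Pre_ex[OF L Par.prems(3) flat(2) Par.prems(6)] by blast
      from P' Q' L eq' show ?thesis
        by (intro exI[of _ "Par P' Q'"]) (auto intro: lts_SyncL simp: ac_simps)
    qed
  next
    assume "(u, S) \<in># comps w Q"
    then obtain J where J: "comps w Q = add_mset (u, S) J" by (rule mset_add)
    with eq have eq': "J + comps w P = add_mset (t, T) K" by (simp add: add.commute)
    then have "(t, T) \<in># J \<or> (t, T) \<in># comps w P"
      by (metis union_iff union_single_eq_member)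
    then show ?thesis
    proof
      assume "(t, T) \<in># J"
      then obtain L where L: "J = add_mset (t, T) L" by (rule mset_add)
      with J Par.IH(2)[of w L] Par.prems flat obtain Q' where
        "lts Q Tau Q'" "comps w Q' = L + comps u C + comps t D" "flat Q'" "locs Q' = locs Q"
        "plain Q \<longrightarrow> plain Q'" by auto
      with L eq' flat show ?thesis
        by (intro exI[of _ "Par P Q'"]) (auto intro: lts_ParR simp: ac_simps)
    next
      assume "(t, T) \<in># comps w P"
      then obtain L where L: "comps w P = add_mset (t, T) L" by (rule mset_add)
      obtain Q' where Q': "lts Q (Pre (In a)) Q'" "comps w Q' = J + comps u C" "flat Q'" "locs Q' = locs Q"
        "plain Q \<longrightarrow> plain Q'"
        using lts_Pre_ex[OF J Par.prems(2) flat(2) Par.prems(5)] by blast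
      obtain P' where P': "lts P (Pre (Out a)) P'" "comps w P' = L + comps t D" "flat P'" "locs P' = locs P"
        "plain P \<longrightarrow> plain P'"
        using lts_Pre_ex[OF L Par.prems(3) flat(1) Par.prems(6)] by blast
      from P' Q' L eq' show ?thesis
        by (intro exI[of _ "Par P' Q'"]) (auto intro: lts_SyncR simp: ac_simps)
    qed
  qed
qed (auto split: if_splits)

lemma lts_upd_Par:
  assumes "comps None R = add_mset (None, S) K" "act S (Upd a (Par (Loc a V) (Sum []))) C"
    and "a \<in># locs P" "flat P" "all_good (comps None P)" "distinct_locs P"
    and "flat R" "a \<notin># locs R" "plain C" "plain V" "\<And>Q. fill V Q = V"
  shows "\<exists>P' R'. lts (Par P R) Tau (Par P' R') \<and> lts (Par R P) Tau (Par R' P') \<and>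
    comps None P' + comps None R' =
      filter_mset (\<lambda>x. fst x \<noteq> Some a) (comps None P + K) + comps None C + comps (Some a) V \<and>
    flat P' \<and> flat R' \<and> locs P' = locs P \<and> locs R' = locs R"
proof -
  let ?U = "Par (Loc a V) (Sum [])"
  obtain Q P' where P': "lts P (Located a Q) P'"
    using lts_Located_ex[OF assms(3,4)] by blast
  note reset = lts_Located_reset[OF P' assms(4-6,10)]
  obtain R' where R': "lts R (Pre (Upd a ?U)) R'" "comps None R' = K + comps None C"
    "flat R'" "locs R' = locs R"
    using lts_Pre_ex[OF assms(1,2,7,9)] by blast
  have fill: "fill ?U Q = ?U"
    using assms(11) by simp
  \<comment> \<open>Both the old content \<open>Q\<close> and the new content \<open>V\<close> are
    plain, so neither contains a location: the trees agree, and \<open>numap Q = 0\<close>.\<close>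
  have cond: "CStr (Loc a Q) = CStr (Par (Loc a (fill V Q)) (Sum []))" "numph ?U > 0 \<longrightarrow> numap Q = 0"
    using assms(10,11) reset(1) by (auto simp: plain_located plain_numap)
  have "filter_mset (\<lambda>x. fst x \<noteq> Some a) K = K"
    using filter_comps[OF assms(7,8)] assms(1) by simp
  then show ?thesis
    using lts_UpdL[OF P' R'(1) refl cond] lts_UpdR[OF R'(1) P' refl cond] reset R'
    unfolding fill
    by (intro exI[of _ "subst_star P' ?U"] exI[of _ R']) (simp add: ac_simps)
qed

lemma lts_upd_ex:
  assumes "comps None P = add_mset (None, S) K" "act S (Upd a (Par (Loc a V) (Sum []))) C"
    and "a \<in># locs P" "flat P" "all_good (comps None P)" "distinct_locs P"
    and "plain C" "plain V" "\<And>Q. fill V Q = V"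
  shows "\<exists>P'. lts P Tau P' \<and>
    comps None P' = filter_mset (\<lambda>x. fst x \<noteq> Some a) K + comps None C + comps (Some a) V \<and>
    flat P' \<and> locs P' = locs P"
  using assms
proof (induction P arbitrary: K)
  case (Loc b P)
  \<comment> \<open>Everything inside a location carries its tag, so the updating component cannot
    be there.\<close>
  then have "(None, S) \<in># comps (Some b) P" "plain P" by auto
  then show ?case using comps_plain by fastforce
next
  case (Par P Q)
  note d = distinct_locs_Par[OF Par.prems(6)]
  have prems: "flat P" "flat Q" "all_good (comps None P)" "all_good (comps None Q)"
    using Par.prems(4,5) by auto
  have eq: "comps None P + comps None Q = add_mset (None, S) K"
    using Par.prems by simp
  then have "(None, S) \<in># comps None P \<or> (None, S) \<in># comps None Q"
    by (metis union_iff union_single_eq_member)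
  then show ?case
  proof
    assume "(None, S) \<in># comps None P"
    then obtain J where J: "comps None P = add_mset (None, S) J" by (rule mset_add)
    with eq have K: "K = J + comps None Q" by simp
    show ?thesis
    proof (cases "a \<in># locs P")
      case True
      obtain P' where P': "lts P Tau P'"
        "comps None P' = filter_mset (\<lambda>x. fst x \<noteq> Some a) J + comps None C + comps (Some a) V"
        "flat P'" "locs P' = locs P"
        using Par.IH(1)[OF J Par.prems(2) True prems(1,3) d(1) Par.prems(7-9)] by blast
      with K filter_comps[OF prems(2) d(3)[OF True]] prems(2) show ?thesis
        by (intro exI[of _ "Par P' Q"]) (auto intro: lts_ParL simp: ac_simps)
    next
      case False
      with Par.prems(3) have "a \<in># locs Q" by simp
      from lts_upd_Par[OF J Par.prems(2) this prems(2,4) d(2) prems(1) False Par.prems(7-9)]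
      obtain Q' P' where "lts (Par P Q) Tau (Par P' Q')" "flat Q'" "flat P'" "locs Q' = locs Q" "locs P' = locs P"
        "comps None Q' + comps None P' =
        filter_mset (\<lambda>x. fst x \<noteq> Some a) (comps None Q + J) + comps None C + comps (Some a) V" by blast
      then show ?thesis
        by (intro exI[of _ "Par P' Q'"]) (simp add: K ac_simps)
    qed
  next
    assume "(None, S) \<in># comps None Q"
    then obtain J where J: "comps None Q = add_mset (None, S) J" by (rule mset_add)
    with eq have K: "K = comps None P + J" by simp
    show ?thesis
    proof (cases "a \<in># locs Q")
      case True
      then have "a \<notin># locs P" using d(3) by blast
      obtain Q' where Q': "lts Q Tau Q'"
        "comps None Q' = filter_mset (\<lambda>x. fst x \<noteq> Some a) J + comps None C + comps (Some a) V"
        "flat Q'" "locs Q' = locs Q"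
        using Par.IH(2)[OF J Par.prems(2) True prems(2,4) d(2) Par.prems(7-9)] by blast
      with K filter_comps[OF prems(1) \<open>a \<notin># locs P\<close>] prems(1) show ?thesis
        by (intro exI[of _ "Par P Q'"]) (auto intro: lts_ParR simp: ac_simps)
    next
      case False
      with Par.prems(3) have "a \<in># locs P" by simp
      from lts_upd_Par[OF J Par.prems(2) this prems(1,3) d(1) prems(2) False Par.prems(7-9)]
      obtain P' Q' where "lts (Par P Q) Tau (Par P' Q')" "flat Q'" "flat P'" "locs Q' = locs Q" "locs P' = locs P"
        "comps None P' + comps None Q' =
        filter_mset (\<lambda>x. fst x \<noteq> Some a) (comps None P + J) + comps None C + comps (Some a) V" by blast
      then show ?thesis
        by (intro exI[of _ "Par P' Q'"]) (simp add: K ac_simps)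
    qed
  qed
qed auto

definition regular :: "name multiset \<Rightarrow> proc \<Rightarrow> bool" where
  "regular A P \<longleftrightarrow> flat P \<and> distinct_locs P \<and> locs P = A \<and> all_good (comps None P)"

lemma reduces_fstep:
  assumes "reduces P P'" "regular A P"
  shows "fstep (set_mset A) (comps None P) (comps None P')"
    and "all_good (comps None P') \<Longrightarrow> regular A P'"
  using lts_Tau[of P P' None] assms by (auto simp: regular_def reduces_def distinct_locs_def)

lemma fstep_reduces:
  assumes "fstep (set_mset A) (comps None P) L" "regular A P" "all_good L"
  shows "\<exists>P'. reduces P P' \<and> comps None P' = L \<and> regular A P'"
  using assms(1)
proof cases
  case (fstep_sync S a C T D w u K)
  then have "good (w, S)" "good (u, T)"
    using assms(2) by (auto simp: regular_def)
  then have "plain C" "plain D"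
    using fstep_sync(3,4) by (auto dest: good_act)
  with lts_sync_ex[OF fstep_sync(1,3,4)] obtain P' where
    "lts P Tau P'" "comps None P' = L" "flat P'" "locs P' = locs P"
    using assms(2) fstep_sync(2) by (auto simp: regular_def)
  then show ?thesis
    using assms(2,3) by (auto simp: regular_def reduces_def distinct_locs_def)
next
  case (fstep_upd S a V C K)
  then have g: "good (None, S)"
    using assms(2) by (auto simp: regular_def)
  from good_act[OF this fstep_upd(3)] have "plain C" .
  moreover from good_Upd[OF g fstep_upd(3)] have "plain V" "\<And>Q. fill V Q = V"
    by auto
  ultimately obtain P' where
    "lts P Tau P'" "comps None P' = L" "flat P'" "locs P' = locs P"
    using lts_upd_ex[OF fstep_upd(1,3)] assms(2) fstep_upd(2,4) by (auto simp: regular_def)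
  then show ?thesis
    using assms(2,3) by (auto simp: regular_def reduces_def distinct_locs_def)
qed

section \<open>Simulating a reset net by a process\<close>

text \<open>
  The tokens of place \<open>p\<close> are inside the located process \<open>p\<close>, except that the fuel, place 0,
  which is never reset, is at the top level.
\<close>

abbreviation enter_name :: "nat \<Rightarrow> name" where
  "enter_name q \<equiv> prod_encode (0, q)"

abbreviation put_name :: "nat \<Rightarrow> name" where
  "put_name p \<equiv> prod_encode (1, p)"

abbreviation take_name :: "nat \<Rightarrow> name" where
  "take_name p \<equiv> prod_encode (2, p)"

text \<open>The first components keep the four kinds of channel apart. No input uses tag 3, so the
  beacon is never consumed. Location names occur only in locations and update prefixes, where a
  coincidence with a channel is harmless.\<close>

abbreviation barb :: "proc pref" where
  "barb \<equiv> Out (prod_encode (3, 0))"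

abbreviation nil :: proc where
  "nil \<equiv> Sum []"

definition token :: "nat \<Rightarrow> proc" where
  "token p = Sum [(Out (take_name p), nil)]"

text \<open>New tokens must appear inside the location of their place, where the continuation of an
  outside prefix cannot put them. A replicated server living there creates them; a reset erases it
  together with the tokens and must reinstall it.\<close>

definition filler :: "nat \<Rightarrow> proc" where
  "filler p = Repl (In (put_name p)) (token p)"

definition loc :: "nat \<Rightarrow> name option" where
  "loc p = (if p = 0 then None else Some p)"

definition beacon :: proc where
  "beacon = Sum [(barb, nil)]"

fun ops_proc :: "op list \<Rightarrow> nat \<Rightarrow> proc" where
  "ops_proc [] q = Sum [(Out (enter_name q), nil)]"
| "ops_proc (Mv s d # ops) q = Sum [(In (take_name s), Sum [(Out (put_name d), ops_proc ops q)])]"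
| "ops_proc (Rst r # ops) q = Sum [(Upd r (Par (Loc r (filler r)) nil), ops_proc ops q)]"

fun control_proc :: "control \<Rightarrow> proc" where
  "control_proc (None, ops, q) = ops_proc ops q"
| "control_proc (Some d, ops, q) = Sum [(Out (put_name d), ops_proc ops q)]"

fun transition_proc :: "nat \<times> op list \<times> nat \<Rightarrow> proc" where
  "transition_proc (q, ops, q') = Repl (In (enter_name q)) (ops_proc ops q')"

definition cell :: "nat \<Rightarrow> nat \<Rightarrow> comp multiset" where
  "cell p m = add_mset (loc p, filler p) (replicate_mset m (loc p, token p))"

definition places :: "nat \<Rightarrow> (nat \<Rightarrow> nat) \<Rightarrow> comp multiset" where
  "places k v = (\<Sum>p<k. cell p (v p))"

definition static :: "net \<Rightarrow> comp multiset" where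
  "static T = add_mset (None, beacon) (image_mset (\<lambda>t. (None, transition_proc t)) (mset T))"

definition conf :: "net \<Rightarrow> nat \<Rightarrow> control \<times> (nat \<Rightarrow> nat) \<Rightarrow> comp multiset" where
  "conf T k = (\<lambda>(c, v). add_mset (None, control_proc c) (static T + places k v))"

fun valid_op :: "nat \<Rightarrow> op \<Rightarrow> bool" where
  "valid_op k (Mv s d) \<longleftrightarrow> s < k \<and> d < k"
| "valid_op k (Rst r) \<longleftrightarrow> 0 < r \<and> r < k"

definition valid_net :: "net \<Rightarrow> nat \<Rightarrow> bool" where
  "valid_net T k \<longleftrightarrow> (\<forall>(q, ops, q') \<in> set T. \<forall>x\<in>set ops. valid_op k x)"

definition valid_control :: "nat \<Rightarrow> control \<Rightarrow> bool" where
  "valid_control k = (\<lambda>(mid, ops, q). (\<forall>d. mid = Some d \<longrightarrow> d < k) \<and> (\<forall>x\<in>set ops. valid_op k x))"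

lemma micro_valid:
  assumes "micro T (c, v) (c', v')" "valid_net T k" "valid_control k c"
  shows "valid_control k c'"
  using assms by cases (auto simp: valid_net_def valid_control_def)

lemma act_simps [simp]:
  "act (Sum ps) \<pi> C \<longleftrightarrow> (\<pi>, C) \<in> set ps"
  "act (Repl \<rho> P) \<pi> C \<longleftrightarrow> \<pi> = \<rho> \<and> C = Par P (Repl \<rho> P)"
  by (auto elim: act.cases intro: act.intros)

lemma places_fun_upd:
  assumes "p < k"
  obtains K where "\<And>x. places k (v(p := x)) = cell p x + K" "places k v = cell p (v p) + K"
    "0 < p \<Longrightarrow> filter_mset (\<lambda>x. fst x \<noteq> Some p) K = K"
proof
  let ?K = "\<Sum>q\<in>{..<k} - {p}. cell q (v q)"
  show eq: "places k (v(p := x)) = cell p x + ?K" for x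
    using assms unfolding places_def by (subst sum.remove[of _ p]) (auto intro!: sum.cong)
  from this[of "v p"] show "places k v = cell p (v p) + ?K" by simp
  show "filter_mset (\<lambda>x. fst x \<noteq> Some p) ?K = ?K" if "0 < p"
    using that by (auto simp: filter_mset_eq_conv set_mset_sum cell_def loc_def split: if_splits)
qed

lemma comps_ops_proc [simp]: "comps w (ops_proc ops q) = {#(w, ops_proc ops q)#}"
  by (cases "(ops, q)" rule: ops_proc.cases) auto

lemma comps_control_proc: "comps w (control_proc c) = {#(w, control_proc c)#}"
  by (cases c rule: control_proc.cases) auto

lemma comps_basic [simp]:
  "comps w (token p) = {#(w, token p)#}" "comps w (filler p) = {#(w, filler p)#}"
  "comps w beacon = {#(w, beacon)#}"
  "comps w (transition_proc t) = {#(w, transition_proc t)#}"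
  by (simp_all add: token_def filler_def beacon_def, cases t) simp

lemma plain_basic [simp]:
  "plain (ops_proc ops q)" "plain (control_proc c)" "plain (token p)" "plain (filler p)"
  "plain beacon" "plain (transition_proc t)"
proof -
  show *: "plain (ops_proc ops q)" for ops q
    by (cases "(ops, q)" rule: ops_proc.cases) auto
  show "plain (control_proc c)"
    by (cases c rule: control_proc.cases) (simp_all add: *)
  show "plain (transition_proc t)"
    by (cases t) simp
qed (simp_all add: token_def filler_def beacon_def)

lemma mem_conf:
  assumes "x \<in># conf T k (c, v)"
  obtains "x = (None, control_proc c)" | "x = (None, beacon)"
  | q ops q' where "(q, ops, q') \<in> set T" "x = (None, transition_proc (q, ops, q'))"
  | p where "p < k" "x = (loc p, filler p)" | p where "p < k" "0 < v p" "x = (loc p, token p)"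
  using assms
  by (auto simp: conf_def static_def places_def set_mset_sum cell_def split: if_splits)

text \<open>With \<open>conf_Out\<close> and \<open>conf_Upd\<close>, an inventory of all offers in
  a configuration; injectivity of \<open>prod_encode\<close> leaves only the intended
  partners.\<close>

lemma conf_In:
  assumes "(w, S) \<in># conf T k (c, v)" "act S (In a) C"
  obtains q ops q' where "(q, ops, q') \<in> set T" "w = None" "S = transition_proc (q, ops, q')"
      "a = enter_name q" "C = Par (ops_proc ops q') S"
  | p where "p < k" "w = loc p" "S = filler p" "a = put_name p" "C = Par (token p) S"
  | s d ops q where "w = None" "S = control_proc c" "c = (None, Mv s d # ops, q)" "a = take_name s"
      "C = control_proc (Some d, ops, q)"
  using assms(1)
proof (cases rule: mem_conf)
  case 1
  with assms(2) that(3) show ?thesis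
    by (cases c rule: control_proc.cases; cases "(fst (snd c), snd (snd c))" rule: ops_proc.cases) auto
qed (use assms(2) that(1,2) in \<open>auto simp: beacon_def filler_def token_def\<close>)

lemma conf_Out:
  assumes "(w, S) \<in># conf T k (c, v)" "act S (Out a) C"
  obtains "Out a = barb"
  | p where "p < k" "0 < v p" "w = loc p" "S = token p" "a = take_name p" "C = nil"
  | q where "w = None" "S = control_proc c" "c = (None, [], q)" "a = enter_name q" "C = nil"
  | d ops q where "w = None" "S = control_proc c" "c = (Some d, ops, q)" "a = put_name d" "C = ops_proc ops q"
  using assms(1)
proof (cases rule: mem_conf)
  case 1
  with assms(2) that(3,4) show ?thesis
    by (cases c rule: control_proc.cases; cases "(fst (snd c), snd (snd c))" rule: ops_proc.cases) auto
qed (use assms(2) that(1,2) in \<open>auto simp: beacon_def filler_def token_def\<close>)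

lemma conf_Upd:
  assumes "(w, S) \<in># conf T k (c, v)" "act S (Upd a U) C"
  obtains ops q where "w = None" "S = control_proc c" "c = (None, Rst a # ops, q)"
    "U = Par (Loc a (filler a)) nil" "C = ops_proc ops q"
  using assms(1)
proof (cases rule: mem_conf)
  case 1
  with assms(2) that show ?thesis
    by (cases c rule: control_proc.cases; cases "(fst (snd c), snd (snd c))" rule: ops_proc.cases) auto
qed (use assms(2) in \<open>auto simp: beacon_def filler_def token_def\<close>)

lemma reset_places:
  assumes "0 < r" "r < k"
  shows "filter_mset (\<lambda>x. fst x \<noteq> Some r) (static T + places k v) + {#(Some r, filler r)#} =
    static T + places k (v(r := 0))"
proof -
  obtain K where K: "\<And>x. places k (v(r := x)) = cell r x + K" "places k v = cell r (v r) + K"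
    "filter_mset (\<lambda>x. fst x \<noteq> Some r) K = K"
    using places_fun_upd[OF assms(2)] assms(1) by metis
  have "filter_mset (\<lambda>x. fst x \<noteq> Some r) (static T) = static T"
    by (auto simp: static_def filter_mset_eq_conv)
  moreover have "filter_mset (\<lambda>x. fst x \<noteq> Some r) (cell r (v r)) = {#}"
    using assms(1) by (auto simp: cell_def loc_def filter_mset_eq_conv)
  moreover have "cell r 0 = {#(Some r, filler r)#}"
    using assms(1) by (simp add: cell_def loc_def)
  ultimately show ?thesis
    by (simp add: K)
qed

text \<open>Every step involves the control: takes are received, and puts and entries are sent, by
  it alone, and it has the only update prefix. Hence processes do nothing beyond the small steps of
  the net.\<close>

lemma fstep_conf:
  assumes "fstep A (conf T k (c, v)) L" "valid_net T k" "valid_control k c"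
  shows "\<exists>c' v'. micro T (c, v) (c', v') \<and> L = conf T k (c', v')"
  using assms(1)
proof cases
  case (fstep_sync S a C S' D w u K)
  have "(w, S) \<in># conf T k (c, v)" "(u, S') \<in># conf T k (c, v)"
    by (simp_all add: fstep_sync(1))
  from conf_In[OF this(1) fstep_sync(3)] show ?thesis
  proof cases
    case (1 q ops q')
    from conf_Out[OF \<open>(u, S') \<in># _\<close> fstep_sync(4)] obtain q2
      where o: "u = None" "S' = control_proc c" "c = (None, [], q2)" "a = enter_name q2" "D = nil"
      by cases (use 1 in auto)
    with 1 have "micro T (c, v) ((None, ops, q'), v)"
      by (auto intro: micro_enter)
    moreover have "static T + places k v = add_mset (w, S) K"
      using fstep_sync(1) o by (simp add: conf_def)
    then have "L = conf T k ((None, ops, q'), v)"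
      using 1 o fstep_sync(2) by (simp add: conf_def)
    ultimately show ?thesis by blast
  next
    case (2 p)
    from conf_Out[OF \<open>(u, S') \<in># _\<close> fstep_sync(4)] obtain ops q
      where o: "u = None" "S' = control_proc c" "c = (Some p, ops, q)" "D = ops_proc ops q"
      by cases (use 2 in auto)
    have "micro T (c, v) ((None, ops, q), v(p := Suc (v p)))"
      unfolding o by (rule micro_put)
    moreover have "static T + places k v = add_mset (w, S) K"
      using fstep_sync(1) o by (simp add: conf_def)
    moreover obtain J where "\<And>x. places k (v(p := x)) = cell p x + J" "places k v = cell p (v p) + J"
      using places_fun_upd[OF \<open>p < k\<close>] by metis
    ultimately have "L = conf T k ((None, ops, q), v(p := Suc (v p)))"
      using 2 o fstep_sync(2) by (simp add: conf_def cell_def)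
    with \<open>micro T _ _\<close> show ?thesis by blast
  next
    case (3 s d ops q)
    from conf_Out[OF \<open>(u, S') \<in># _\<close> fstep_sync(4)]
    have o: "s < k" "0 < v s" "u = loc s" "S' = token s" "D = nil"
      by (cases; use 3 in auto)+
    have "micro T (c, v) ((Some d, ops, q), v(s := v s - 1))"
      unfolding 3 using o by (intro micro_take)
    moreover have "static T + places k v = add_mset (u, S') K"
      using fstep_sync(1) 3 by (simp add: conf_def)
    moreover obtain J where "\<And>x. places k (v(s := x)) = cell s x + J" "places k v = cell s (v s) + J"
      using places_fun_upd[OF \<open>s < k\<close>] by metis
    moreover have "cell s (v s) = add_mset (loc s, token s) (cell s (v s - 1))"
      using o(2) by (cases "v s") (auto simp: cell_def)
    ultimately have "L = conf T k ((Some d, ops, q), v(s := v s - 1))"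
      using 3 o fstep_sync(2) by (simp add: conf_def comps_control_proc del: control_proc.simps)
    with \<open>micro T _ _\<close> show ?thesis by blast
  qed
next
  case (fstep_upd S a V C K)
  have "(None, S) \<in># conf T k (c, v)"
    by (simp add: fstep_upd(1))
  from conf_Upd[OF this fstep_upd(3)] obtain ops q where
    o: "S = control_proc c" "c = (None, Rst a # ops, q)" "V = filler a" "C = ops_proc ops q"
    by auto
  have a: "0 < a" "a < k"
    using assms(3) o(2) by (auto simp: valid_control_def)
  have "K = static T + places k v"
    using fstep_upd(1) o(1) by (simp add: conf_def)
  then have "L = conf T k ((None, ops, q), v(a := 0))"
    using reset_places[OF a, of T v] fstep_upd(2) o by (simp add: conf_def ac_simps)
  moreover have "micro T (c, v) ((None, ops, q), v(a := 0))"
    unfolding o by (rule micro_reset)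
  ultimately show ?thesis by blast
qed

lemma conf_fstep:
  assumes "micro T (c, v) (c', v')" "valid_net T k" "valid_control k c"
  shows "fstep {1..<k} (conf T k (c, v)) (conf T k (c', v'))"
  using assms(1)
proof cases
  case (micro_enter q ops q')
  let ?S = "transition_proc (q, ops, q')"
  from micro_enter have "(None, ?S) \<in># static T + places k v"
    by (force simp: static_def)
  then obtain K where K: "static T + places k v = add_mset (None, ?S) K"
    by (rule mset_add)
  have "fstep {1..<k} (add_mset (None, ?S) (add_mset (None, control_proc c) K))
      (K + comps None (Par (ops_proc ops q') ?S) + comps None nil)"
    by (rule fstep_sync[of _ "enter_name q"]) (auto simp: micro_enter)
  then show ?thesis
    using K micro_enter by (simp add: conf_def add_mset_commute)
next
  case (micro_take s d ops q)
  then have s: "s < k"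
    using assms(3) by (simp add: valid_control_def)
  obtain J where J: "\<And>x. places k (v(s := x)) = cell s x + J" "places k v = cell s (v s) + J"
    using places_fun_upd[OF s] by metis
  have cell: "cell s (v s) = add_mset (loc s, token s) (cell s (v s - 1))"
    using micro_take by (cases "v s") (auto simp: cell_def)
  have "fstep {1..<k} (add_mset (None, control_proc c) (add_mset (loc s, token s) (static T + cell s (v s - 1) + J)))
      (static T + cell s (v s - 1) + J + comps None (control_proc (Some d, ops, q)) + comps (loc s) nil)"
    by (rule fstep_sync[of _ "take_name s"]) (auto simp: micro_take token_def)
  then show ?thesis
    using micro_take J cell
    by (simp add: conf_def comps_control_proc add.assoc del: control_proc.simps)
next
  case (micro_put d ops q)
  then have d: "d < k"
    using assms(3) by (simp add: valid_control_def)
  obtain J where J: "\<And>x. places k (v(d := x)) = cell d x + J" "places k v = cell d (v d) + J"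
    using places_fun_upd[OF d] by metis
  have "fstep {1..<k} (add_mset (loc d, filler d) (add_mset (None, control_proc c)
        (static T + replicate_mset (v d) (loc d, token d) + J)))
      (static T + replicate_mset (v d) (loc d, token d) + J + comps (loc d) (Par (token d) (filler d)) +
        comps None (ops_proc ops q))"
    by (rule fstep_sync[of _ "put_name d"]) (auto simp: micro_put filler_def)
  then show ?thesis
    using micro_put J by (simp add: conf_def cell_def add.assoc add_mset_commute)
next
  case (micro_reset r ops q)
  then have r: "0 < r" "r < k"
    using assms(3) by (auto simp: valid_control_def)
  have "fstep {1..<k} (add_mset (None, control_proc c) (static T + places k v))
     (filter_mset (\<lambda>x. fst x \<noteq> Some r) (static T + places k v) + comps None (ops_proc ops q) + comps (Some r) (filler r))"
    by (rule fstep_upd) (use r in \<open>auto simp: micro_reset\<close>)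
  then show ?thesis
    using reset_places[OF r, of T v] micro_reset by (simp add: conf_def ac_simps)
qed

lemma subst_star_basic [simp]:
  "subst_star (ops_proc ops q) X = ops_proc ops q" "subst_star (control_proc c) X = control_proc c"
  "subst_star (token p) X = token p" "subst_star (filler p) X = filler p"
  "subst_star beacon X = beacon" "subst_star (transition_proc t) X = transition_proc t"
proof -
  show *: "subst_star (ops_proc ops q) X = ops_proc ops q" for ops q
    by (induction ops q rule: ops_proc.induct) auto
  show "subst_star (control_proc c) X = control_proc c"
    by (cases c rule: control_proc.cases) (simp_all add: *)
  show "subst_star (transition_proc t) X = transition_proc t"
    by (cases t) (simp add: *)
qed (simp_all add: token_def filler_def beacon_def)

lemma all_good_conf: "all_good (conf T k (c, v))"
  unfolding all_good_def
proof
  fix x assume "x \<in># conf T k (c, v)"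
  then show "good x"
  proof (cases rule: mem_conf)
    case 1
    have "fill (filler r) Q = filler r" for r Q
      by (simp add: filler_def token_def)
    with 1 show ?thesis
      by (cases c rule: control_proc.cases; cases "(fst (snd c), snd (snd c))" rule: ops_proc.cases)
        (auto simp: good_def)
  qed (simp_all add: good_def, auto simp: beacon_def filler_def token_def)
qed

definition simulates :: "net \<Rightarrow> nat \<Rightarrow> control \<times> (nat \<Rightarrow> nat) \<Rightarrow> proc \<Rightarrow> bool" where
  "simulates T k x P \<longleftrightarrow> regular (mset [1..<k]) P \<and> comps None P = conf T k x \<and>
     valid_net T k \<and> valid_control k (fst x)"

lemma simulates_reduces:
  assumes "simulates T k x P" "reduces P P'"
  shows "\<exists>y. micro T x y \<and> simulates T k y P'"
proof -
  obtain c v where x: "x = (c, v)" by fastforce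
  have P: "regular (mset [1..<k]) P" "comps None P = conf T k (c, v)" "valid_net T k" "valid_control k c"
    using assms(1) by (auto simp: simulates_def x)
  from reduces_fstep(1)[OF assms(2) P(1)] obtain c' v'
    where *: "micro T (c, v) (c', v')" "comps None P' = conf T k (c', v')"
    using fstep_conf P by metis
  with reduces_fstep(2)[OF assms(2) P(1)] all_good_conf have "regular (mset [1..<k]) P'"
    by simp
  with * show ?thesis
    using micro_valid[OF *(1) P(3,4)] P(3) x
    by (intro exI[of _ "(c', v')"]) (simp add: simulates_def)
qed

lemma simulates_micro:
  assumes "simulates T k x P" "micro T x y"
  shows "\<exists>P'. reduces P P' \<and> simulates T k y P'"
proof -
  obtain c v c' v' where x: "x = (c, v)" "y = (c', v')" by fastforce
  have P: "regular (mset [1..<k]) P" "comps None P = conf T k (c, v)" "valid_net T k" "valid_control k c"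
    using assms(1) by (auto simp: simulates_def x)
  have "fstep (set_mset (mset [1..<k])) (comps None P) (conf T k (c', v'))"
    using conf_fstep[of T c v c' v' k] assms(2) P x by simp
  from fstep_reduces[OF this P(1) all_good_conf] obtain P' where
    "reduces P P'" "comps None P' = conf T k (c', v')" "regular (mset [1..<k]) P'" by blast
  then show ?thesis
    using micro_valid[of T c v c' v' k] assms(2) P x by (auto simp: simulates_def)
qed

lemma simulates_barb:
  assumes "simulates T k x P"
  shows "has_barb P barb"
proof -
  obtain c v where x: "x = (c, v)" by fastforce
  have P: "flat P" "comps None P = conf T k (c, v)"
    using assms by (auto simp: simulates_def x regular_def)
  then have "(None, beacon) \<in># comps None P"
    by (simp add: conf_def static_def)
  then obtain K where "comps None P = add_mset (None, beacon) K"
    by (rule mset_add)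
  from lts_Pre_ex[OF this _ P(1), of barb nil] show ?thesis
    by (auto simp: has_barb_def beacon_def)
qed

text \<open>The barb is present in every simulating process, and \<open>simulates\<close> is a
  bisimulation, so it carries infinite runs both ways.\<close>

lemma has_barb_omega_iff:
  assumes "simulates T k x P"
  shows "has_barb_omega P barb \<longleftrightarrow> infinite_run (micro T) x"
proof
  assume "has_barb_omega P barb"
  then obtain Q where Q: "reduces\<^sup>*\<^sup>* P (Q 0)" "\<And>i. reduces (Q i) (Q (Suc i))"
    unfolding has_barb_omega_def by blast
  show "infinite_run (micro T) x"
  \<comment> \<open>Reaching some \<open>Q i\<close> is all that is kept, which also covers the
    finite computation before \<open>Q 0\<close>.\<close>
  proof (rule infinite_run_coinduct[where P = "\<lambda>x. \<exists>P i. reduces\<^sup>*\<^sup>* P (Q i) \<and> simulates T k x P"])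
    fix x assume "\<exists>P i. reduces\<^sup>*\<^sup>* P (Q i) \<and> simulates T k x P"
    then obtain P i where P: "reduces\<^sup>*\<^sup>* P (Q i)" "simulates T k x P" by blast
    have "reduces\<^sup>+\<^sup>+ P (Q (Suc i))"
      using P(1) Q(2) by (rule rtranclp_into_tranclp1)
    then obtain P' where "reduces P P'" "reduces\<^sup>*\<^sup>* P' (Q (Suc i))"
      by (metis tranclpD)
    then show "\<exists>y. micro T x y \<and> (\<exists>P i. reduces\<^sup>*\<^sup>* P (Q i) \<and> simulates T k y P)"
      using simulates_reduces[OF P(2)] by blast
  qed (use Q(1) assms in blast)
next
  assume "infinite_run (micro T) x"
  have "infinite_run (\<lambda>P P'. reduces P P' \<and> has_barb P barb) P"
  proof (rule infinite_run_coinduct[where P = "\<lambda>P. \<exists>x. infinite_run (micro T) x \<and> simulates T k x P"])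
    fix P assume "\<exists>x. infinite_run (micro T) x \<and> simulates T k x P"
    then obtain x y where "micro T x y" "infinite_run (micro T) y" "simulates T k x P"
      using infinite_run_step by metis
    then show "\<exists>P'. (reduces P P' \<and> has_barb P barb) \<and> (\<exists>x. infinite_run (micro T) x \<and> simulates T k x P')"
      using simulates_micro simulates_barb by blast
  qed (use assms \<open>infinite_run (micro T) x\<close> in blast)
  then show "has_barb_omega P barb"
    unfolding infinite_run_def has_barb_omega_def by (metis rtranclp.rtrancl_refl)
qed

section \<open>The instances\<close>

definition pars :: "proc list \<Rightarrow> proc" where
  "pars Ps = foldr Par Ps nil"

definition place_proc :: "nat \<Rightarrow> proc" where
  "place_proc p = (if p = 0 then filler p else Loc p (filler p))"

definition net_proc :: "net \<Rightarrow> nat \<Rightarrow> nat \<Rightarrow> proc" where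
  "net_proc T h k = Par (Par beacon (ops_proc [] h))
     (Par (pars (map transition_proc T)) (pars (map place_proc [0..<k])))"

text \<open>The loading transition is the only part that mentions \<open>n\<close>, so
  \<open>P\<close> may be fixed before \<open>n\<close> is.\<close>

definition instance_proc :: "proc \<Rightarrow> nat \<Rightarrow> proc" where
  "instance_proc P n = Par P (transition_proc (0, load n, 1))"

lemma comps_pars: "comps w (pars Ps) = sum_list (map (comps w) Ps)"
  by (induction Ps) (auto simp: pars_def)

lemma locs_pars: "locs (pars Ps) = sum_list (map locs Ps)"
  by (induction Ps) (auto simp: pars_def)

lemma flat_pars: "flat (pars Ps) \<longleftrightarrow> (\<forall>P\<in>set Ps. flat P)"
  by (induction Ps) (auto simp: pars_def)

lemma comps_copies: "comps w (copies m P) = repeat_mset m (comps w P)"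
  by (induction m P rule: copies.induct) auto

lemma plain_copies: "plain P \<Longrightarrow> plain (copies m P)"
  by (induction m P rule: copies.induct) auto

lemma comps_places: "comps None (pars (map place_proc [0..<k])) = (\<Sum>p<k. {#(loc p, filler p)#})"
proof -
  have "comps None (place_proc p) = {#(loc p, filler p)#}" for p
    by (simp add: place_proc_def loc_def)
  then show ?thesis
    by (induction k) (simp_all add: comps_pars)
qed

lemma places_fuel: "0 < k \<Longrightarrow> places k (fuel m) = (\<Sum>p<k. {#(loc p, filler p)#}) + replicate_mset m (None, token 0)"
proof -
  assume "0 < k"
  have "places k (fuel m) = (\<Sum>p<k. {#(loc p, filler p)#} + replicate_mset (fuel m p) (loc p, token p))"
    by (simp add: places_def cell_def)
  also have "\<dots> = (\<Sum>p<k. {#(loc p, filler p)#}) + (\<Sum>p<k. replicate_mset (fuel m p) (loc p, token p))"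
    by (rule sum.distrib)
  also have "(\<Sum>p<k. replicate_mset (fuel m p) (loc p, token p)) = replicate_mset m (None, token 0)"
    using \<open>0 < k\<close> by (subst sum.remove[of _ 0]) (auto simp: fuel_def loc_def)
  finally show ?thesis .
qed

lemma locs_places: "0 < k \<Longrightarrow> locs (pars (map place_proc [0..<k])) = mset [1..<k]"
proof -
  assume "0 < k"
  have "sum_list (map (locs \<circ> place_proc) xs) = mset xs" if "0 \<notin> set xs" for xs
    using that by (induction xs) (auto simp: place_proc_def filler_def)
  from this[of "[1..<k]"] show ?thesis
    using \<open>0 < k\<close> by (simp add: locs_pars upt_conv_Cons[of 0 k] place_proc_def filler_def del: mset_upt)
qed

text \<open>The \<open>m\<close> copies of \<open>token 0\<close> stay outside all locations and
  thus form \<open>m\<close> units of fuel; for \<open>m = 0\<close> the inactive process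
  contributes no component. The control starts in \<open>h\<close>.\<close>

lemma simulates_instance:
  assumes "valid_net (T @ [(0, load n, 1)]) k" "0 < k"
  shows "simulates (T @ [(0, load n, 1)]) k ((None, [], h), fuel m)
    (Par (instance_proc (net_proc T h k) n) (copies m (token 0)))"
    (is "simulates ?T k ?x ?P")
proof -
  have "locs (pars (map transition_proc T)) = {#}"
    by (induction T) (auto simp: pars_def plain_locs)
  moreover have "locs (copies m (token 0)) = {#}"
    by (intro plain_locs plain_copies) simp
  ultimately have locs: "locs ?P = mset [1..<k]"
    using locs_places[OF assms(2)]
    by (simp add: instance_proc_def net_proc_def beacon_def plain_locs del: transition_proc.simps)
  have "comps None (pars (map transition_proc T)) = image_mset (\<lambda>t. (None, transition_proc t)) (mset T)"
    by (induction T) (auto simp: pars_def)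
  then have comps: "comps None ?P = conf ?T k ?x"
    using assms(2)
    by (simp add: conf_def static_def instance_proc_def net_proc_def comps_places places_fuel comps_copies
        repeat_mset_replicate_mset ac_simps del: ops_proc.simps transition_proc.simps)
  have "flat (pars (map transition_proc T))" "flat (pars (map place_proc [0..<k]))" "flat (copies m (token 0))"
    by (auto simp: flat_pars place_proc_def plain_flat plain_copies)
  then have "flat ?P"
    by (simp add: instance_proc_def net_proc_def plain_flat del: ops_proc.simps transition_proc.simps)
  moreover have "distinct_locs ?P"
    unfolding distinct_locs_def locs by (simp add: count_mset_set')
  ultimately show ?thesis
    using assms(1) all_good_conf comps locs
    by (simp add: simulates_def regular_def valid_control_def fuel_def)
qed

lemma valid_net_of:
  assumes "\<And>q a q'. (q, a, q') \<in> set M \<Longrightarrow> register a + 2 < k" "2 < k"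
  shows "valid_net (net_of M h k n) k"
proof -
  have "\<forall>x\<in>set (ops_of a). valid_op k x" if "(q, a, q') \<in> set M" for q a q'
    using assms(1)[OF that] by (cases a) auto
  then show ?thesis
    using assms(2) by (fastforce simp: valid_net_def net_of_def base_net_def load_def)
qed

section \<open>Membership in the fragment\<close>

lemma Es2_A_nil: "Es2_A nil"
  by (auto intro: Es2_proc_Es2_A_Es2_pref_Es2_pat.intros)

lemma Es2_A_Sum1: "Es2_pref \<pi> \<Longrightarrow> Es2_A A \<Longrightarrow> Es2_A (Sum [(\<pi>, A)])"
  by (auto intro: Es2_proc_Es2_A_Es2_pref_Es2_pat.intros)

lemma Es2_A_filler: "Es2_A (token p)" "Es2_A (filler p)"
  unfolding filler_def token_def
  by (intro Es2_A_Sum1 Es2_A_nil Es2_proc_Es2_A_Es2_pref_Es2_pat.intros)+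

lemma Es2_A_ops_proc: "Es2_A (ops_proc ops q)"
proof (induction ops q rule: ops_proc.induct)
  case (3 r ops q)
  have "Es2_pref (Upd r (Par (Loc r (filler r)) nil))"
    using Es2_A_filler(2) Es2_A_nil by (meson Es2_proc_Es2_A_Es2_pref_Es2_pat.intros)
  with 3 show ?case by (simp add: Es2_A_Sum1)
qed (auto intro!: Es2_A_Sum1 Es2_A_nil intro: Es2_proc_Es2_A_Es2_pref_Es2_pat.intros)

lemma Es2_A_transition: "Es2_A (transition_proc t)"
  by (cases t) (auto intro!: Es2_proc_Es2_A_Es2_pref_Es2_pat.intros(5) Es2_A_ops_proc
      Es2_proc_Es2_A_Es2_pref_Es2_pat.intros)

lemma Es2_proc_pars: "(\<And>P. P \<in> set Ps \<Longrightarrow> Es2_proc P) \<Longrightarrow> Es2_proc (pars Ps)"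
  by (induction Ps) (auto simp: pars_def intro: Es2_proc_Es2_A_Es2_pref_Es2_pat.intros(2,3) Es2_A_nil)

lemma Es2_proc_instance: "Es2_proc (instance_proc (net_proc T h k) n)"
proof -
  have "Es2_proc (place_proc p)" for p
    by (auto simp: place_proc_def intro: Es2_proc_Es2_A_Es2_pref_Es2_pat.intros(1,3) Es2_A_filler)
  moreover have "Es2_proc beacon"
    unfolding beacon_def
    by (intro Es2_proc_Es2_A_Es2_pref_Es2_pat.intros(3) Es2_A_Sum1 Es2_A_nil Es2_proc_Es2_A_Es2_pref_Es2_pat.intros)
  moreover have "Es2_proc (transition_proc t)" for t
    by (intro Es2_proc_Es2_A_Es2_pref_Es2_pat.intros(3) Es2_A_transition)
  moreover have "Es2_proc (ops_proc ops q)" for ops q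
    by (intro Es2_proc_Es2_A_Es2_pref_Es2_pat.intros(3) Es2_A_ops_proc)
  ultimately show ?thesis
    unfolding instance_proc_def net_proc_def
    by (auto intro!: Es2_proc_Es2_A_Es2_pref_Es2_pat.intros(2) Es2_proc_pars
        simp del: ops_proc.simps transition_proc.simps)
qed

lemma BC_singleton: "BC P {Q} = {Par P (copies m Q) | m. True}"
proof -
  have *: "distinct Ps \<and> set Ps = {Q} \<longleftrightarrow> Ps = [Q]" for Ps
    by (cases Ps) (auto simp: subset_singleton_iff)
  have "R \<in> BC P {Q} \<longleftrightarrow> (\<exists>ms. R = foldl Par P (map2 copies ms [Q]) \<and> length ms = 1)" for R
    unfolding BC_def conj_assoc[symmetric] * by auto
  moreover have "(\<exists>ms :: nat list. R = F ms \<and> length ms = 1) \<longleftrightarrow> (\<exists>m. R = F [m])" for R :: proc and F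
    by (auto simp: length_Suc_conv)
  ultimately show ?thesis
    by auto
qed

section \<open>Diagonalisation\<close>

fun the_instance :: "proc \<Rightarrow> nat \<Rightarrow> proc \<times> proc list \<times> proc pref" where
  "the_instance P n = (instance_proc P n, [token 0], barb)"

lemma EA_the_instance:
  "EA (the_instance P n) \<longleftrightarrow> (\<forall>m. \<not> has_barb_omega (Par (instance_proc P n) (copies m (token 0))) barb)"
  by (auto simp: eventual_adaptation_def BC_singleton)

text \<open>
  The code of the instance is computable from \<open>n\<close> and the code of \<open>P\<close>. Hence a machine may
  ask a decision procedure about the process \<open>P\<close> that encodes the machine itself.
\<close>

lemma recursive_code_load: "recursive 1 (\<lambda>xs. code_proc (ops_proc (load (xs ! 0)) 1))"
proof -
  \<comment> \<open>\<open>B r\<close> is the code of one operation \<open>Mv 0 2\<close> in front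
    of a process with code \<open>r\<close>: tag 4 is \<open>Sum\<close>, tags 0 and 1 are
    \<open>In\<close> and \<open>Out\<close>, and \<open>Suc (prod_encode (x, 0))\<close> is the
    code of the list \<open>[x]\<close>.\<close>
  define B where "B r = prod_encode (4, Suc (prod_encode (prod_encode (prod_encode (0, take_name 0),
    prod_encode (4, Suc (prod_encode (prod_encode (prod_encode (1, put_name 2), r), 0)))), 0)))" for r
  have *: "code_proc (ops_proc (load n) 1) = rec_nat (code_proc (ops_proc [] 1)) (\<lambda>_. B) n" for n
    by (induction n) (simp_all add: load_def B_def)
  have "recursive 2 (\<lambda>xs. B (xs ! 1))"
    unfolding B_def by (intro recursive_prod_encode recursive_const recursive_Suc recursive_nth) simp
  then show ?thesis
    unfolding * by (intro recursive_iterate recursive_nth) simp_all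
qed

lemma recursive_code_instance:
  obtains f where "\<And>P. computes f [code_proc P] (code_instance (the_instance P (code_proc P)))"
proof -
  \<comment> \<open>The code of the instance when both the code of \<open>P\<close> and
    \<open>n\<close> equal the argument; 3 is the tag of \<open>Par\<close>, 5 of
    \<open>Repl\<close>, 0 of \<open>In\<close>.\<close>
  define F where "F xs = prod_encode (prod_encode (3, prod_encode (xs ! 0,
      prod_encode (5, prod_encode (prod_encode (0, enter_name 0), code_proc (ops_proc (load (xs ! 0)) 1))))),
    prod_encode (list_encode [code_proc (token 0)], code_pref code_proc barb))" for xs
  have "recursive 1 F"
    unfolding F_def by (intro recursive_prod_encode recursive_const recursive_nth recursive_code_load) simp
  then obtain f where "\<And>xs. length xs = 1 \<Longrightarrow> computes f xs (F xs)"
    unfolding recursive_def by blast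
  then have "computes f [code_proc P] (F [code_proc P])" for P
    by simp
  then show thesis
    by (intro that[of f]) (simp add: F_def instance_proc_def)
qed

theorem theorem7p28:
  shows "\<not> decidable code_instance EA_instances EA"
proof
  assume "decidable code_instance EA_instances EA"
  then obtain f where f: "\<And>x. x \<in> EA_instances \<Longrightarrow> computes f [code_instance x] (if EA x then 1 else 0)"
    unfolding decidable_def by blast
  obtain g where g: "\<And>P. computes g [code_proc P] (code_instance (the_instance P (code_proc P)))"
    using recursive_code_instance by blast
  \<comment> \<open>This recursion yields 1 at 0 and 0 elsewhere, which exchanges the two answers of
    the decision procedure.\<close>
  have "recursive 1 (\<lambda>xs. rec_nat (1 :: nat) (\<lambda>_ _. 0) (xs ! 0))"
    by (intro recursive_iterate recursive_const recursive_nth) simp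
  then obtain neg where "\<And>xs. length xs = 1 \<Longrightarrow> computes neg xs (rec_nat 1 (\<lambda>_ _. 0) (xs ! 0))"
    unfolding recursive_def by blast
  from this[of "[0]"] this[of "[1]"] have neg: "computes neg [0] 1" "computes neg [1] 0"
    by simp_all
  \<comment> \<open>On the code of \<open>P\<close>, the function \<open>d\<close> yields 0 exactly
    if eventual adaptation holds for \<open>P\<close> with its own code loaded, provided this is a
    legitimate instance.\<close>
  define d where "d = Comp neg [Comp f [g]]"
  obtain M h where h: "h > 1"
    and labels: "\<And>q a q'. (q, a, q') \<in> set M \<Longrightarrow> q \<noteq> 0 \<and> q \<noteq> h \<and> q' \<noteq> 0"
    and halts: "\<And>n y. computes d [n] y \<Longrightarrow> (\<exists>\<sigma>. (mstep M)\<^sup>*\<^sup>* (1, init n) (h, \<sigma>)) \<longleftrightarrow> y = 0"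
    by (rule machine_halts_iff[of d]) blast
  \<comment> \<open>Register \<open>r\<close> occupies place \<open>r + 2\<close>, hence the summand
    3; inserting 0 makes the maximum defined for an empty machine and ensures
    \<open>k > 2\<close>.\<close>
  define k where "k = Max (insert 0 ((\<lambda>(q, a, q'). register a) ` set M)) + 3"
  have registers: "register a + 2 < k" if "(q, a, q') \<in> set M" for q a q'
  proof -
    have "register a \<le> Max (insert 0 ((\<lambda>(q, a, q'). register a) ` set M))"
      using that by (intro Max_ge) force+
    then show ?thesis by (simp add: k_def)
  qed
  \<comment> \<open>\<open>M\<close> comes from \<open>d\<close> alone and \<open>base_net\<close>
    does not mention \<open>n\<close>, so taking the code of \<open>P\<close> for \<open>n\<close>
    is not circular.\<close>
  define P where "P = net_proc (base_net M h k) h k"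
  define n where "n = code_proc P"
  interpret net M h k n
    by standard (use h labels registers in \<open>auto simp: k_def\<close>)
  have "the_instance P n \<in> EA_instances"
    using Es2_proc_instance Es2_A_filler(1) Es2_proc_Es2_A_Es2_pref_Es2_pat.intros(3)
    by (auto simp: EA_instances_def P_def is_barb_def)
  from f[OF this] have "computes d [n] (if EA (the_instance P n) then 0 else 1)"
    unfolding d_def
    by (intro computes.intros(4)[of _ _ "[if EA (the_instance P n) then 1 else 0]"]
        computes.intros(4)[of _ _ "[code_instance (the_instance P n)]"])
      (use g[of P] neg in \<open>auto simp: n_def intro!: computes.intros(4)\<close>)
  \<comment> \<open>The machine halts exactly if eventual adaptation holds, whereas by the
    simulation it halts exactly if some amount of fuel admits an infinite computation, that is, if
    eventual adaptation fails.\<close>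
  from halts[OF this] have "EA (the_instance P n) \<longleftrightarrow> (\<exists>\<sigma>. (mstep M)\<^sup>*\<^sup>* (1, init n) (h, \<sigma>))"
    by simp
  also have "\<dots> \<longleftrightarrow> (\<exists>m. infinite_run (micro N) ((None, [], h), fuel m))"
    using infinite_run_of_halting halting_of_infinite_run by blast
  also have "\<dots> \<longleftrightarrow> (\<exists>m. has_barb_omega (Par (instance_proc P n) (copies m (token 0))) barb)"
    using has_barb_omega_iff[OF simulates_instance] valid_net_of[of M k h n, OF registers k] k
    unfolding P_def net_of_def by simp
  also have "\<dots> \<longleftrightarrow> \<not> EA (the_instance P n)"
    by (simp only: EA_the_instance not_all not_not)
  finally show False by blast
qed

end
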